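(* Let $G=G_1\,\Box\,\cdots\,\Box\,G_D$, where exactly $d$ factors are cycle digraphs and $D-d$ factors are simple directed paths. Let $M=(S^1)^d\times[0,1]^{D-d}$ be the corresponding product space, with singular Betti numbers $\beta_k(M)$. Then: - if every cycle factor has an even number of vertices and every path factor has an odd number of vertices, $$\frac{\dim\ker\mathcal D(G)}{r}=\sum_{k=0}^D\beta_k(M);$$ - for arbitrary numbers of vertices, $$\frac{\dim\ker\mathcal D(G)}{r}\le\sum_{k=0}^D\beta_k(M).$$
   Context: The cycle digraph $C_n$ ($n\ge3$) has vertex set $\{1,\dots,n\}$ and edges $i\to i+1$ for $1\le i\le n-1$ together with $n\to1$. The simple directed path $P_n$ ($n\ge2$) has vertex set $\{1,\dots,n\}$ and edges $i\to i+1$ for $1\le i\le n-1$. For a directed graph without multiple edges, the anti-symmetrized adjacency matrix $A_{\mathrm{as}}$ is the $|V|\times|V|$ matrix with: - $(A_{\mathrm{as}})_{ij}=1$ if an edge leaves $i$ and enters $j$; - $(A_{\mathrm{as}})_{ij}=-1$ if an edge leaves $j$ and enters $i$; - $(A_{\mathrm{as}})_{ij}=0$ otherwise. Let $\gamma_1,\dots,\gamma_D$ be complex $r\times r$ matrices satisfying $\gamma_\mu\gamma_\nu+\gamma_\nu\gamma_\mu=2\delta_{\mu\nu}\mathbf 1_r$. For $G_\mu$ with $n_\mu$ vertices, the free massless naive lattice Dirac operator is $$\mathcal D(G)=\sum_{\mu=1}^D\Big(\mathbf 1_{n_D}\otimes\cdots\otimes\mathbf 1_{n_{\mu+1}}\otimes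 A_{\mathrm{as}}(G_\mu)\otimes\mathbf 1_{n_{\mu-1}}\otimes\cdots\otimes\mathbf 1_{n_1}\Big)\otimes\gamma_\mu,$$ where $\otimes$ is the Kronecker product and $\mathbf 1_k$ is the $k\times k$ identity. *)

theory Defs
  imports "HOL-Homology.Homology" "Jordan_Normal_Form.Matrix_Kernel"
begin

datatype factor = Cycle nat | Path nat

fun nverts :: "factor \<Rightarrow> nat" where
  "nverts (Cycle n) = n"
| "nverts (Path n) = n"

fun is_cycle :: "factor \<Rightarrow> bool" where
  "is_cycle (Cycle n) = True"
| "is_cycle (Path n) = False"

fun edges :: "factor \<Rightarrow> (nat \<times> nat) set" where
  "edges (Cycle n) = {(i, i + 1) | i. 1 \<le> i \<and> i \<le> n - 1} \<union> {(n, 1)}"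
| "edges (Path n) = {(i, i + 1) | i. 1 \<le> i \<and> i \<le> n - 1}"

fun wf_factor :: "factor \<Rightarrow> bool" where
  "wf_factor (Cycle n) = (n \<ge> 3)"
| "wf_factor (Path n) = (n \<ge> 2)"

text \<open>Anti-symmetrized adjacency matrix; vertex k in {1..n} is row/column k-1.\<close>
definition antisym_adj :: "nat \<Rightarrow> (nat \<times> nat) set \<Rightarrow> complex mat" where
  "antisym_adj n E = mat n n (\<lambda>(i, j).
     if (i + 1, j + 1) \<in> E then 1 else if (j + 1, i + 1) \<in> E then -1 else 0)"

definition A_as :: "factor \<Rightarrow> complex mat" where
  "A_as G = antisym_adj (nverts G) (edges G)"

definition kron :: "'a :: times mat \<Rightarrow> 'a mat \<Rightarrow> 'a mat" where
  "kron A B = mat (dim_row A * dim_row B) (dim_col A * dim_col B)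
     (\<lambda>(i, j). A $$ (i div dim_row B, j div dim_col B) * B $$ (i mod dim_row B, j mod dim_col B))"

text \<open>For a list [M_1,...,M_D], kron_chain gives M_D \<otimes> ... \<otimes> M_1.\<close>
definition kron_chain :: "complex mat list \<Rightarrow> complex mat" where
  "kron_chain Ms = foldl (\<lambda>T M. kron M T) (1\<^sub>m 1) Ms"

text \<open>Gs = [G_1,...,G_D]; gamma mu is \<gamma>_(mu+1).\<close>
definition dirac :: "factor list \<Rightarrow> nat \<Rightarrow> (nat \<Rightarrow> complex mat) \<Rightarrow> complex mat" where
  "dirac Gs r \<gamma> = foldr (+)
     (map (\<lambda>\<mu>. kron (kron_chain (map (\<lambda>\<nu>. if \<nu> = \<mu> then A_as (Gs ! \<nu>) else 1\<^sub>m (nverts (Gs ! \<nu>)))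
                                   [0..<length Gs])) (\<gamma> \<mu>)) [0..<length Gs])
     (0\<^sub>m ((\<Prod>G\<leftarrow>Gs. nverts G) * r) ((\<Prod>G\<leftarrow>Gs. nverts G) * r))"

definition clifford :: "nat \<Rightarrow> nat \<Rightarrow> (nat \<Rightarrow> complex mat) \<Rightarrow> bool" where
  "clifford D r \<gamma> \<longleftrightarrow> (\<forall>\<mu> < D. \<gamma> \<mu> \<in> carrier_mat r r) \<and>
     (\<forall>\<mu> < D. \<forall>\<nu> < D. \<gamma> \<mu> * \<gamma> \<nu> + \<gamma> \<nu> * \<gamma> \<mu> = (if \<mu> = \<nu> then 2 \<cdot>\<^sub>m 1\<^sub>m r else 0\<^sub>m r r))"

definition circle_top :: "complex topology" where
  "circle_top = subtopology euclidean (sphere 0 1)"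

definition interval_top :: "complex topology" where
  "interval_top = subtopology euclidean (complex_of_real ` {0..1})"

definition product_space :: "factor list \<Rightarrow> (nat \<Rightarrow> complex) topology" where
  "product_space Gs = product_topology
     (\<lambda>i. if is_cycle (Gs ! i) then circle_top else interval_top) {..<length Gs}"

definition group_rank :: "('a, 'b) monoid_scheme \<Rightarrow> nat" where
  "group_rank G = Sup {card S | S. S \<subseteq> carrier G \<and> finite S \<and>
      (\<forall>c :: 'a \<Rightarrow> int. finprod G (\<lambda>s. s [^]\<^bsub>G\<^esub> c s) S = \<one>\<^bsub>G\<^esub> \<longrightarrow> (\<forall>s\<in>S. c s = 0))}"

definition betti :: "int \<Rightarrow> 'a topology \<Rightarrow> nat" where
  "betti k X = group_rank (homology_group k X)"

end

theory Submission
  imports Defs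
begin

text \<open>
  Both sides reduce to powers of two. By the Clifford relations the square of the Dirac operator is
  the sum of the squares of its commuting anti-Hermitian summands, each tensored with the identity
  on spinors. Pairing with a kernel vector writes \<open>0\<close> as minus a sum of squared norms, so the
  kernel is the joint kernel of the one-dimensional difference operators, that is, the tensor
  product of the kernels for the factors and the spinor space. A difference operator forces period
  two: an even cycle contributes dimension 2, an odd cycle 1, an odd path 1 and an even path 0.

  On the topological side, a contractible factor does not change homology, and
  \<open>H\<^sub>p(X \<times> S\<^sup>1) \<cong> H\<^sub>p(X) \<oplus> H\<^sub>p\<^sub>-\<^sub>1(X)\<close>. Hence the Betti numbers of the product are binomial
  coefficients with upper index the number of cycles.
\<close>

text \<open>The gamma matrices obey only the Clifford relations and need not be Hermitian, so the
  Dirac operator need not be normal and its own quadratic form does not control its kernel. Its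
  square contains no gamma matrix any more, and the difference operators in it are real and
  antisymmetric; positivity is therefore applied to the square. The converse inclusion holds because
  each summand has a difference operator as right factor.

  The joint kernel is carried through the induction on the factors in coordinates, not as an
  abstract tensor product: the entries of a kernel vector are fixed multiples of a few free entries,
  this form survives products, and the number of free entries is the dimension.

  On the topological side the induction carries the homology groups themselves, up to isomorphism
  with \<open>int_vec m\<close>. Direct sums become concatenation of integer vectors, and the rank
  is read off once at the end.\<close>

unbundle no vec_syntax and no inner_syntax

section \<open>Kronecker products\<close>

lemma div_mod_less:
  fixes i :: nat
  assumes "i < m * n"
  shows "i div n < m" "i mod n < n"
proof -
  have "n > 0" using assms by (cases n) auto
  with assms show "i div n < m" "i mod n < n" by (simp_all add: less_mult_imp_div_less)
qed

lemma mult_add_less: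
  fixes i :: nat
  assumes "i < m" "j < n"
  shows "i * n + j < m * n"
proof -
  have "i * n + j < Suc i * n" using assms by simp
  also have "\<dots> \<le> m * n" using assms by (intro mult_le_mono1) simp
  finally show ?thesis .
qed

lemma sum_div_mod:
  fixes f :: "nat \<Rightarrow> nat \<Rightarrow> 'a::comm_monoid_add"
  shows "(\<Sum>k<m * n. f (k div n) (k mod n)) = (\<Sum>i<m. \<Sum>j<n. f i j)"
proof -
  have "(\<Sum>k<m * n. f (k div n) (k mod n)) = (\<Sum>(i, j)\<in>{..<m} \<times> {..<n}. f i j)"
  proof (rule sum.reindex_bij_witness[where i = "\<lambda>(i, j). i * n + j" and j = "\<lambda>k. (k div n, k mod n)"])
    fix b assume "b \<in> {..<m} \<times> {..<n}"
    then show "(case b of (i, j) \<Rightarrow> i * n + j) \<in> {..<m * n}" by (auto intro: mult_add_less)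
  next
    fix a assume "a \<in> {..<m * n}"
    then show "(a div n, a mod n) \<in> {..<m} \<times> {..<n}" using div_mod_less by auto
  qed auto
  then show ?thesis by (simp add: sum.cartesian_product)
qed

lemma kron_carrier [simp, intro]:
  "A \<in> carrier_mat a b \<Longrightarrow> B \<in> carrier_mat c d \<Longrightarrow> kron A B \<in> carrier_mat (a * c) (b * d)"
  by (auto simp: kron_def)

lemma index_kron:
  assumes "A \<in> carrier_mat a b" "B \<in> carrier_mat c d" "i < a * c" "j < b * d"
  shows "kron A B $$ (i, j) = A $$ (i div c, j div d) * B $$ (i mod c, j mod d)"
  using assms by (auto simp: kron_def)

text \<open>The mixed-product rule. The entries must commute because those of \<open>B\<close> and
  \<open>C\<close> change places.\<close>

lemma mult_kron:
  fixes A B C D :: "'a::comm_semiring_0 mat"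
  assumes A: "A \<in> carrier_mat a b" and B: "B \<in> carrier_mat b e"
    and C: "C \<in> carrier_mat c d" and D: "D \<in> carrier_mat d f"
  shows "kron A C * kron B D = kron (A * B) (C * D)"
proof (rule eq_matI)
  have AC: "kron A C \<in> carrier_mat (a * c) (b * d)" and BD: "kron B D \<in> carrier_mat (b * d) (e * f)"
    and AB: "A * B \<in> carrier_mat a e" and CD: "C * D \<in> carrier_mat c f"
    using assms by auto
  fix i j assume "i < dim_row (kron (A * B) (C * D))" "j < dim_col (kron (A * B) (C * D))"
  then have i: "i < a * c" and j: "j < e * f" using assms by (auto simp: kron_def)
  note i' = div_mod_less[OF i] and j' = div_mod_less[OF j]
  have "(kron A C * kron B D) $$ (i, j) = (\<Sum>k<b * d. kron A C $$ (i, k) * kron B D $$ (k, j))"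
    using AC BD i j by (auto simp: scalar_prod_def lessThan_atLeast0 intro!: sum.cong)
  also have "\<dots> = (\<Sum>k<b * d. (A $$ (i div c, k div d) * B $$ (k div d, j div f)) *
                              (C $$ (i mod c, k mod d) * D $$ (k mod d, j mod f)))"
    using i j by (intro sum.cong) (auto simp: index_kron[OF A C] index_kron[OF B D] mult_ac)
  also have "\<dots> = (\<Sum>p<b. A $$ (i div c, p) * B $$ (p, j div f)) * (\<Sum>q<d. C $$ (i mod c, q) * D $$ (q, j mod f))"
    by (simp only: sum_div_mod[of "\<lambda>p q. (A $$ (i div c, p) * B $$ (p, j div f)) * (C $$ (i mod c, q) * D $$ (q, j mod f))"]
         sum_product)
  also have "\<dots> = (A * B) $$ (i div c, j div f) * (C * D) $$ (i mod c, j mod f)"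
    using assms i' j' by (auto simp: scalar_prod_def lessThan_atLeast0)
  finally show "(kron A C * kron B D) $$ (i, j) = kron (A * B) (C * D) $$ (i, j)"
    using i j by (simp add: index_kron[OF AB CD])
qed (use assms in \<open>auto simp: kron_def\<close>)

lemma kron_one: "kron (1\<^sub>m a) (1\<^sub>m b) = (1\<^sub>m (a * b) :: 'a::semiring_1 mat)"
proof (rule eq_matI)
  fix i j assume "i < dim_row (1\<^sub>m (a * b))" "j < dim_col (1\<^sub>m (a * b))"
  then have ij: "i < a * b" "j < a * b" by auto
  have "i div b = j div b \<and> i mod b = j mod b \<longleftrightarrow> i = j" by (metis div_mult_mod_eq)
  then show "kron (1\<^sub>m a) (1\<^sub>m b) $$ (i, j) = (1\<^sub>m (a * b) :: 'a mat) $$ (i, j)"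
    using ij div_mod_less[OF ij(1)] div_mod_less[OF ij(2)] by (auto simp: kron_def)
qed (auto simp: kron_def)

lemma kron_assoc:
  fixes A B C :: "'a::semigroup_mult mat"
  shows "kron (kron A B) C = kron A (kron B C)"
proof (rule eq_matI)
  let ?A = "kron A (kron B C)"
  fix i j assume "i < dim_row ?A" "j < dim_col ?A"
  then have i: "i < dim_row A * dim_row B * dim_row C" and j: "j < dim_col A * dim_col B * dim_col C"
    by (auto simp: kron_def mult.assoc)
  have i': "i < dim_row A * (dim_row B * dim_row C)" and j': "j < dim_col A * (dim_col B * dim_col C)"
    using i j by (auto simp: mult.assoc)
  note b = div_mod_less[OF i] div_mod_less[OF j] div_mod_less[OF i'] div_mod_less[OF j']
  \<comment> \<open>An index into a triple product has three mixed-radix digits; these equations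
    show that both bracketings extract the same ones.\<close>
  have eq: "k mod (n * m) div m = k div m mod n" "k mod (n * m) mod m = k mod m"
      "k div m div n = k div (n * m)" for k m n :: nat
    by (simp_all add: mod_mult2_eq mult.commute[of n m] div_mult2_eq mod_mult_self4)
       (cases "m = 0", auto simp: mod_mult2_eq)
  show "kron (kron A B) C $$ (i, j) = ?A $$ (i, j)"
    using i j i' j' b by (simp add: kron_def eq mult.assoc)
qed (auto simp: kron_def mult.assoc)

lemma kron_add_right:
  fixes A B C :: "'a::semiring mat"
  assumes "A \<in> carrier_mat a b" "B \<in> carrier_mat c d" "C \<in> carrier_mat c d"
  shows "kron A (B + C) = kron A B + kron A C"
  using assms div_mod_less by (intro eq_matI) (auto simp: kron_def distrib_left)

lemma kron_zero_right:
  fixes A :: "'a::semiring_0 mat"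
  assumes "A \<in> carrier_mat a b"
  shows "kron A (0\<^sub>m c d) = 0\<^sub>m (a * c) (b * d)"
  using assms div_mod_less by (intro eq_matI) (auto simp: kron_def)

section \<open>Sums of pairwise anticommuting matrices\<close>

lemma foldr_add_carrier:
  assumes "\<And>x. x \<in> set xs \<Longrightarrow> X x \<in> carrier_mat n m"
  shows "foldr (+) (map X xs) (0\<^sub>m n m) \<in> carrier_mat n m"
  using assms by (induction xs) auto

lemma anticommute_foldr_add:
  fixes Z :: "'a::comm_ring_1 mat"
  assumes Z: "Z \<in> carrier_mat n n" and "\<And>x. x \<in> set xs \<Longrightarrow> X x \<in> carrier_mat n n"
    and "\<And>x. x \<in> set xs \<Longrightarrow> Z * X x + X x * Z = 0\<^sub>m n n"
  shows "Z * foldr (+) (map X xs) (0\<^sub>m n n) + foldr (+) (map X xs) (0\<^sub>m n n) * Z = 0\<^sub>m n n"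
  using assms(2,3)
proof (induction xs)
  case Nil
  then show ?case using Z by simp
next
  case (Cons x xs)
  let ?F = "foldr (+) (map X xs) (0\<^sub>m n n)"
  have F: "?F \<in> carrier_mat n n" and X: "X x \<in> carrier_mat n n"
    using Cons.prems by (auto intro!: foldr_add_carrier)
  have "Z * (X x + ?F) + (X x + ?F) * Z = (Z * X x + Z * ?F) + (X x * Z + ?F * Z)"
    using F X Z by (simp add: mult_add_distrib_mat add_mult_distrib_mat[of _ n n])
  also have "\<dots> = (Z * X x + X x * Z) + (Z * ?F + ?F * Z)"
    using F X Z by (intro eq_matI) (auto simp: ac_simps)
  also have "\<dots> = 0\<^sub>m n n"
    using Cons by simp
  finally show ?case by simp
qed

text \<open>The cross terms cancel in pairs. Distinctness matters: the cross terms of a repeated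
  index would be squares, which need not cancel.\<close>

lemma square_foldr_add_anticommuting:
  fixes X :: "'b \<Rightarrow> 'a::comm_ring_1 mat"
  assumes "distinct xs" "\<And>x. x \<in> set xs \<Longrightarrow> X x \<in> carrier_mat n n"
    and "\<And>x y. \<lbrakk>x \<in> set xs; y \<in> set xs; x \<noteq> y\<rbrakk> \<Longrightarrow> X x * X y + X y * X x = 0\<^sub>m n n"
  shows "foldr (+) (map X xs) (0\<^sub>m n n) * foldr (+) (map X xs) (0\<^sub>m n n)
       = foldr (+) (map (\<lambda>x. X x * X x) xs) (0\<^sub>m n n)"
  using assms
proof (induction xs)
  case (Cons x xs)
  let ?F = "foldr (+) (map X xs) (0\<^sub>m n n)"
  have F: "?F \<in> carrier_mat n n" and X: "X x \<in> carrier_mat n n"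
    using Cons.prems by (auto intro!: foldr_add_carrier)
  have anti: "X x * ?F + ?F * X x = 0\<^sub>m n n"
    by (rule anticommute_foldr_add[OF X]) (use Cons.prems in auto)
  have "(X x + ?F) * (X x + ?F) = X x * (X x + ?F) + ?F * (X x + ?F)"
    using F X by (intro add_mult_distrib_mat[of _ n n]) auto
  also have "\<dots> = (X x * X x + X x * ?F) + (?F * X x + ?F * ?F)"
    using F X by (simp add: mult_add_distrib_mat[of _ n n])
  also have "\<dots> = X x * X x + ((X x * ?F + ?F * X x) + ?F * ?F)"
    using F X by (intro eq_matI) (auto simp: ac_simps)
  also have "\<dots> = X x * X x + ?F * ?F"
    using F X by (simp add: anti)
  also have "?F * ?F = foldr (+) (map (\<lambda>x. X x * X x) xs) (0\<^sub>m n n)"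
    using Cons by auto
  finally show ?case by simp
qed simp

lemma scalar_prod_foldr_add_mult_vec:
  fixes X :: "'b \<Rightarrow> 'a::comm_ring_1 mat"
  assumes "\<And>x. x \<in> set xs \<Longrightarrow> X x \<in> carrier_mat n n" and v: "v \<in> carrier_vec n" and u: "u \<in> carrier_vec n"
  shows "(foldr (+) (map X xs) (0\<^sub>m n n) *\<^sub>v v) \<bullet> u = (\<Sum>x\<leftarrow>xs. (X x *\<^sub>v v) \<bullet> u)"
  using assms(1)
proof (induction xs)
  case Nil
  have "0\<^sub>m n n *\<^sub>v v = 0\<^sub>v n" using v by (intro eq_vecI) auto
  then show ?case using u by simp
next
  case (Cons x xs)
  let ?F = "foldr (+) (map X xs) (0\<^sub>m n n)"
  have F: "?F \<in> carrier_mat n n" and X: "X x \<in> carrier_mat n n"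
    using Cons.prems by (auto intro!: foldr_add_carrier)
  have "((X x + ?F) *\<^sub>v v) \<bullet> u = (X x *\<^sub>v v) \<bullet> u + (?F *\<^sub>v v) \<bullet> u"
    using F X u v by (subst add_mult_distrib_mat_vec[of _ n n]) (auto intro!: add_scalar_prod_distrib[of _ n])
  with Cons show ?case by simp
qed

section \<open>The kernel of the Dirac operator\<close>

text \<open>One parameter covers Hermitian (\<open>\<epsilon> = 1\<close>) and anti-Hermitian
  (\<open>\<epsilon> = -1\<close>) matrices, so that Kronecker products simply multiply the
  signs.\<close>

definition eps_hermitian :: "complex \<Rightarrow> nat \<Rightarrow> complex mat \<Rightarrow> bool" where
  "eps_hermitian \<epsilon> n M \<longleftrightarrow> M \<in> carrier_mat n n \<and> (\<forall>i<n. \<forall>j<n. M $$ (j, i) = \<epsilon> * cnj (M $$ (i, j)))"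

lemma eps_hermitian_carrier: "eps_hermitian \<epsilon> n M \<Longrightarrow> M \<in> carrier_mat n n"
  unfolding eps_hermitian_def by blast

lemma eps_hermitian_kron:
  assumes "eps_hermitian \<epsilon> m A" "eps_hermitian \<delta> n B"
  shows "eps_hermitian (\<epsilon> * \<delta>) (m * n) (kron A B)"
proof -
  have A: "A \<in> carrier_mat m m" and B: "B \<in> carrier_mat n n"
    using assms by (auto dest: eps_hermitian_carrier)
  have "kron A B $$ (j, i) = \<epsilon> * \<delta> * cnj (kron A B $$ (i, j))" if "i < m * n" "j < m * n" for i j
  proof -
    have "A $$ (j div n, i div n) = \<epsilon> * cnj (A $$ (i div n, j div n))"
      "B $$ (j mod n, i mod n) = \<delta> * cnj (B $$ (i mod n, j mod n))"
      using assms div_mod_less[OF that(1)] div_mod_less[OF that(2)] unfolding eps_hermitian_def by blast+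
    then show ?thesis using that by (simp add: index_kron[OF A B])
  qed
  with A B show ?thesis unfolding eps_hermitian_def by blast
qed

lemma eps_hermitian_one: "eps_hermitian 1 n (1\<^sub>m n)"
  by (auto simp: eps_hermitian_def)

text \<open>Well-formedness excludes loops and pairs of opposite edges. A cycle of length 2 would
  give a symmetric matrix instead.\<close>

lemma eps_hermitian_A_as:
  assumes "wf_factor G"
  shows "eps_hermitian (-1) (nverts G) (A_as G)"
  using assms by (cases G) (auto simp: eps_hermitian_def A_as_def antisym_adj_def)

lemma eps_hermitian_cscalar_prod:
  assumes M: "eps_hermitian \<epsilon> n M" and u: "u \<in> carrier_vec n" and v: "v \<in> carrier_vec n"
  shows "(M *\<^sub>v u) \<bullet>c v = \<epsilon> * (u \<bullet>c (M *\<^sub>v v))"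
proof -
  have Mc: "M \<in> carrier_mat n n" and Mh: "\<And>i j. \<lbrakk>i < n; j < n\<rbrakk> \<Longrightarrow> M $$ (i, j) = \<epsilon> * cnj (M $$ (j, i))"
    using M unfolding eps_hermitian_def by blast+
  have "(M *\<^sub>v u) \<bullet>c v = (\<Sum>i<n. \<Sum>j<n. M $$ (i, j) * u $ j * cnj (v $ i))"
    using Mc u v by (auto simp: scalar_prod_def lessThan_atLeast0 sum_distrib_right intro!: sum.cong)
  also have "\<dots> = (\<Sum>i<n. \<Sum>j<n. \<epsilon> * (u $ j * cnj (M $$ (j, i) * v $ i)))"
    by (intro sum.cong refl) (subst Mh, auto)
  also have "\<dots> = (\<Sum>j<n. \<Sum>i<n. \<epsilon> * (u $ j * cnj (M $$ (j, i) * v $ i)))"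
    by (rule sum.swap)
  also have "\<dots> = \<epsilon> * (u \<bullet>c (M *\<^sub>v v))"
    using Mc u v by (auto simp: scalar_prod_def lessThan_atLeast0 sum_distrib_left intro!: sum.cong)
  finally show ?thesis .
qed

lemma cscalar_prod_self:
  fixes v :: "complex vec"
  shows "v \<bullet>c v = complex_of_real (\<Sum>i<dim_vec v. (cmod (v $ i))\<^sup>2)"
  by (simp add: scalar_prod_def lessThan_atLeast0 complex_norm_square del: of_real_power)

text \<open>The summands \<open>X x\<close> need not be anti-Hermitian; the matrices
  \<open>C x\<close> are, and have the same squares. For \<open>v\<close> in the kernel of the sum,
  pairing its square applied to \<open>v\<close> with \<open>v\<close> gives minus the sum of the
  squared norms of \<open>C x *\<^sub>v v\<close>, so each of these vanishes. The left cofactors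
  \<open>R x\<close> give the converse. In the application \<open>C x\<close> is the summand with
  its gamma matrix replaced by the identity.\<close>

lemma kernel_foldr_anticommuting:
  assumes dist: "distinct xs"
    and X: "\<And>x. x \<in> set xs \<Longrightarrow> X x \<in> carrier_mat n n"
    and anti: "\<And>x y. \<lbrakk>x \<in> set xs; y \<in> set xs; x \<noteq> y\<rbrakk> \<Longrightarrow> X x * X y + X y * X x = 0\<^sub>m n n"
    and C: "\<And>x. x \<in> set xs \<Longrightarrow> eps_hermitian (-1) n (C x)"
    and sq: "\<And>x. x \<in> set xs \<Longrightarrow> X x * X x = C x * C x"
    and R: "\<And>x. x \<in> set xs \<Longrightarrow> R x \<in> carrier_mat n n"
    and XRC: "\<And>x. x \<in> set xs \<Longrightarrow> X x = R x * C x"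
  shows "mat_kernel (foldr (+) (map X xs) (0\<^sub>m n n)) = {v \<in> carrier_vec n. \<forall>x\<in>set xs. C x *\<^sub>v v = 0\<^sub>v n}"
    (is "mat_kernel ?F = _")
proof -
  have Cc: "C x \<in> carrier_mat n n" if "x \<in> set xs" for x
    using C[OF that] by (rule eps_hermitian_carrier)
  have F: "?F \<in> carrier_mat n n" by (rule foldr_add_carrier) (rule X)
  have sqF: "?F * ?F = foldr (+) (map (\<lambda>x. X x * X x) xs) (0\<^sub>m n n)"
    by (rule square_foldr_add_anticommuting[OF dist]) (use X anti in auto)
  have "C x *\<^sub>v v = 0\<^sub>v n" if v: "v \<in> carrier_vec n" and Fv: "?F *\<^sub>v v = 0\<^sub>v n" and x: "x \<in> set xs" for v x
  proof -
    define N where "N x = (\<Sum>i<n. (cmod ((C x *\<^sub>v v) $ i))\<^sup>2)" for x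
    have "0 = ((?F * ?F) *\<^sub>v v) \<bullet>c v"
    proof -
      have "(?F * ?F) *\<^sub>v v = ?F *\<^sub>v 0\<^sub>v n" using F v Fv by simp
      also have "\<dots> = 0\<^sub>v n" using F by (intro eq_vecI) (auto simp: scalar_prod_def)
      finally show ?thesis using v by simp
    qed
    also have "\<dots> = (\<Sum>x\<leftarrow>xs. ((X x * X x) *\<^sub>v v) \<bullet>c v)"
      unfolding sqF
      by (rule scalar_prod_foldr_add_mult_vec) (use X v in \<open>auto intro!: mult_carrier_mat[of _ n n]\<close>)
    also have "\<dots> = (\<Sum>x\<leftarrow>xs. - complex_of_real (N x))"
    proof (intro arg_cong[of _ _ sum_list] map_cong refl)
      fix x assume x: "x \<in> set xs"
      have "((X x * X x) *\<^sub>v v) \<bullet>c v = (C x *\<^sub>v (C x *\<^sub>v v)) \<bullet>c v"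
        using sq[OF x] Cc[OF x] v by simp
      also have "\<dots> = - ((C x *\<^sub>v v) \<bullet>c (C x *\<^sub>v v))"
        using eps_hermitian_cscalar_prod[OF C[OF x], of "C x *\<^sub>v v" v] Cc[OF x] v by simp
      also have "\<dots> = - complex_of_real (N x)"
        using Cc[OF x] by (simp add: cscalar_prod_self N_def)
      finally show "((X x * X x) *\<^sub>v v) \<bullet>c v = - complex_of_real (N x)" .
    qed
    also have "\<dots> = - complex_of_real (\<Sum>x\<leftarrow>xs. N x)"
      by (induction xs) auto
    finally have "(\<Sum>x\<leftarrow>xs. N x) = 0"
      by (metis neg_equal_0_iff_equal of_real_eq_0_iff)
    then have "N x = 0"
      using x by (subst (asm) sum_list_nonneg_eq_0_iff) (auto simp: N_def sum_nonneg)
    then show ?thesis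
      using Cc[OF x] by (intro eq_vecI) (auto simp: N_def sum_nonneg_eq_0_iff)
  qed
  moreover have "?F *\<^sub>v v = 0\<^sub>v n" if v: "v \<in> carrier_vec n" and Cv: "\<forall>x\<in>set xs. C x *\<^sub>v v = 0\<^sub>v n" for v
  proof -
    have "X x *\<^sub>v v = 0\<^sub>v n" if "x \<in> set xs" for x
    proof -
      have "X x *\<^sub>v v = R x *\<^sub>v (C x *\<^sub>v v)"
        using XRC[OF that] R[OF that] Cc[OF that] v by simp
      also have "\<dots> = 0\<^sub>v n" using R[OF that] Cv that by (intro eq_vecI) (auto simp: scalar_prod_def)
      finally show ?thesis .
    qed
    then have "foldr (+) (map X ys) (0\<^sub>m n n) *\<^sub>v v = 0\<^sub>v n" if "set ys \<subseteq> set xs" for ys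
      using that
    proof (induction ys)
      case Nil
      then show ?case using v by (intro eq_vecI) (auto simp: scalar_prod_def)
    next
      case (Cons y ys)
      have "foldr (+) (map X ys) (0\<^sub>m n n) \<in> carrier_mat n n"
        using Cons.prems X by (intro foldr_add_carrier) auto
      with Cons X[of y] v show ?case by (simp add: add_mult_distrib_mat_vec[of _ n n])
    qed
    then show ?thesis by blast
  qed
  ultimately show ?thesis unfolding mat_kernel[OF F] by auto
qed

section \<open>Difference operators on the product lattice\<close>

abbreviation total_verts :: "factor list \<Rightarrow> nat" where
  "total_verts Gs \<equiv> \<Prod>G\<leftarrow>Gs. nverts G"

text \<open>The scalar part of one summand of the Dirac operator: the unnormalized central
  difference in direction \<open>\<mu>\<close>.\<close>

definition lattice_derivative :: "factor list \<Rightarrow> nat \<Rightarrow> complex mat" where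
  "lattice_derivative Gs \<mu> = kron_chain (map (\<lambda>\<nu>. if \<nu> = \<mu> then A_as (Gs ! \<nu>) else 1\<^sub>m (nverts (Gs ! \<nu>)))
     [0..<length Gs])"

lemma A_as_carrier [simp]: "A_as G \<in> carrier_mat (nverts G) (nverts G)"
  by (simp add: A_as_def antisym_adj_def)

lemma lattice_derivative_Nil: "lattice_derivative [] \<mu> = 1\<^sub>m 1"
  by (simp add: lattice_derivative_def kron_chain_def)

text \<open>The last factor of the list is the leftmost tensor slot, so appending a factor is one
  Kronecker product on the left. This is why the inductions over the factors run from the end of the
  list.\<close>

lemma lattice_derivative_snoc:
  "lattice_derivative (Gs @ [G]) \<mu> =
     kron (if \<mu> = length Gs then A_as G else 1\<^sub>m (nverts G)) (lattice_derivative Gs \<mu>)"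
proof -
  have "map (\<lambda>\<nu>. if \<nu> = \<mu> then A_as ((Gs @ [G]) ! \<nu>) else 1\<^sub>m (nverts ((Gs @ [G]) ! \<nu>))) [0..<length Gs]
      = map (\<lambda>\<nu>. if \<nu> = \<mu> then A_as (Gs ! \<nu>) else 1\<^sub>m (nverts (Gs ! \<nu>))) [0..<length Gs]"
    by (rule map_cong) (auto simp: nth_append)
  then show ?thesis
    unfolding lattice_derivative_def kron_chain_def
    by (simp del: map_eq_conv)
qed

lemma lattice_derivative_carrier:
  "lattice_derivative Gs \<mu> \<in> carrier_mat (total_verts Gs) (total_verts Gs)"
proof (induction Gs rule: rev_induct)
  case (snoc G Gs)
  then show ?case
    using kron_carrier[of _ "nverts G" "nverts G", OF _ snoc]
    by (auto simp: lattice_derivative_snoc mult.commute)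
qed (simp add: lattice_derivative_Nil)

text \<open>Covers the step in which the appended factor itself carries the difference operator: all
  earlier slots are then identities.\<close>

lemma lattice_derivative_outside: "\<mu> \<ge> length Gs \<Longrightarrow> lattice_derivative Gs \<mu> = 1\<^sub>m (total_verts Gs)"
  by (induction Gs rule: rev_induct)
     (auto simp: lattice_derivative_Nil lattice_derivative_snoc kron_one mult.commute)

text \<open>In every slot the two matrices are equal or one of them is the identity.\<close>

lemma lattice_derivative_commute:
  "lattice_derivative Gs \<mu> * lattice_derivative Gs \<nu> = lattice_derivative Gs \<nu> * lattice_derivative Gs \<mu>"
proof (induction Gs rule: rev_induct)
  case (snoc G Gs)
  let ?P = "\<lambda>\<mu>. if \<mu> = length Gs then A_as G else 1\<^sub>m (nverts G)"
  have P: "?P \<mu> \<in> carrier_mat (nverts G) (nverts G)" for \<mu> by simp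
  have "?P \<mu> * ?P \<nu> = ?P \<nu> * ?P \<mu>"
    by (simp add: left_mult_one_mat[OF A_as_carrier] right_mult_one_mat[OF A_as_carrier])
  then show ?case
    unfolding lattice_derivative_snoc
    by (simp only: mult_kron[OF P P lattice_derivative_carrier lattice_derivative_carrier] snoc)
qed (simp add: lattice_derivative_Nil)

lemma eps_hermitian_lattice_derivative:
  assumes "\<forall>G\<in>set Gs. wf_factor G" "\<mu> < length Gs"
  shows "eps_hermitian (-1) (total_verts Gs) (lattice_derivative Gs \<mu>)"
  using assms
proof (induction Gs rule: rev_induct)
  case (snoc G Gs)
  show ?case
  proof (cases "\<mu> = length Gs")
    case True
    then have "eps_hermitian 1 (total_verts Gs) (lattice_derivative Gs \<mu>)"
      by (simp add: lattice_derivative_outside eps_hermitian_one)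
    from eps_hermitian_kron[OF eps_hermitian_A_as[of G] this] True snoc.prems show ?thesis
      by (simp add: lattice_derivative_snoc mult.commute)
  next
    case False
    with snoc have "eps_hermitian (-1) (total_verts Gs) (lattice_derivative Gs \<mu>)" by auto
    from eps_hermitian_kron[OF eps_hermitian_one[of "nverts G"] this] False show ?thesis
      by (simp add: lattice_derivative_snoc mult.commute)
  qed
qed simp

lemma mat_kernel_dirac:
  assumes wf: "\<forall>G\<in>set Gs. wf_factor G" and cliff: "clifford (length Gs) r \<gamma>"
  shows "mat_kernel (dirac Gs r \<gamma>) = {v \<in> carrier_vec (total_verts Gs * r).
           \<forall>\<mu><length Gs. kron (lattice_derivative Gs \<mu>) (1\<^sub>m r) *\<^sub>v v = 0\<^sub>v (total_verts Gs * r)}"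
proof -
  let ?N = "total_verts Gs"
  let ?n = "?N * r"
  let ?L = "lattice_derivative Gs"
  note L = lattice_derivative_carrier[of Gs]
  have \<gamma>: "\<gamma> \<mu> \<in> carrier_mat r r" if "\<mu> < length Gs" for \<mu>
    using cliff that by (simp add: clifford_def)
  have anti: "\<gamma> \<mu> * \<gamma> \<nu> + \<gamma> \<nu> * \<gamma> \<mu> = 0\<^sub>m r r" if "\<mu> < length Gs" "\<nu> < length Gs" "\<mu> \<noteq> \<nu>" for \<mu> \<nu>
    using cliff that by (simp add: clifford_def)
  have sq: "\<gamma> \<mu> * \<gamma> \<mu> = 1\<^sub>m r" if "\<mu> < length Gs" for \<mu>
  proof (rule eq_matI)
    fix i j assume ij: "i < dim_row (1\<^sub>m r)" "j < dim_col (1\<^sub>m r)"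
    have "\<gamma> \<mu> * \<gamma> \<mu> + \<gamma> \<mu> * \<gamma> \<mu> = 2 \<cdot>\<^sub>m 1\<^sub>m r"
      using cliff that by (simp add: clifford_def)
    from arg_cong[OF this, of "\<lambda>M. M $$ (i, j)"] ij \<gamma>[OF that]
    show "(\<gamma> \<mu> * \<gamma> \<mu>) $$ (i, j) = 1\<^sub>m r $$ (i, j)" by (auto split: if_splits)
  qed (use \<gamma>[OF that] in auto)
  have "mat_kernel (foldr (+) (map (\<lambda>\<mu>. kron (?L \<mu>) (\<gamma> \<mu>)) [0..<length Gs]) (0\<^sub>m ?n ?n)) =
     {v \<in> carrier_vec ?n. \<forall>\<mu>\<in>set [0..<length Gs]. kron (?L \<mu>) (1\<^sub>m r) *\<^sub>v v = 0\<^sub>v ?n}"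
  proof (rule kernel_foldr_anticommuting[where R = "\<lambda>\<mu>. kron (1\<^sub>m ?N) (\<gamma> \<mu>)"])
    fix \<mu> assume "\<mu> \<in> set [0..<length Gs]"
    then have \<mu>: "\<mu> < length Gs" by simp
    show "kron (?L \<mu>) (\<gamma> \<mu>) \<in> carrier_mat ?n ?n" "kron (1\<^sub>m ?N) (\<gamma> \<mu>) \<in> carrier_mat ?n ?n"
      using L \<gamma>[OF \<mu>] by auto
    show "kron (?L \<mu>) (\<gamma> \<mu>) = kron (1\<^sub>m ?N) (\<gamma> \<mu>) * kron (?L \<mu>) (1\<^sub>m r)"
      using mult_kron[OF one_carrier_mat L \<gamma>[OF \<mu>] one_carrier_mat] \<gamma>[OF \<mu>] L
      by (simp add: left_mult_one_mat[OF L])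
    show "kron (?L \<mu>) (\<gamma> \<mu>) * kron (?L \<mu>) (\<gamma> \<mu>) = kron (?L \<mu>) (1\<^sub>m r) * kron (?L \<mu>) (1\<^sub>m r)"
      by (simp add: mult_kron[OF L L \<gamma>[OF \<mu>] \<gamma>[OF \<mu>]] mult_kron[OF L L one_carrier_mat one_carrier_mat] sq[OF \<mu>])
    show "eps_hermitian (-1) ?n (kron (?L \<mu>) (1\<^sub>m r))"
      using eps_hermitian_kron[OF eps_hermitian_lattice_derivative[OF wf \<mu>] eps_hermitian_one] by simp
    fix \<nu> assume "\<nu> \<in> set [0..<length Gs]" and neq: "\<mu> \<noteq> \<nu>"
    then have \<nu>: "\<nu> < length Gs" by simp
    \<comment> \<open>As the lattice parts commute, both products share the same left factor and the
      anticommutator of the gamma matrices splits off on the right.\<close>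
    have "kron (?L \<mu>) (\<gamma> \<mu>) * kron (?L \<nu>) (\<gamma> \<nu>) + kron (?L \<nu>) (\<gamma> \<nu>) * kron (?L \<mu>) (\<gamma> \<mu>)
        = kron (?L \<mu> * ?L \<nu>) (\<gamma> \<mu> * \<gamma> \<nu> + \<gamma> \<nu> * \<gamma> \<mu>)"
      unfolding mult_kron[OF L L \<gamma>[OF \<mu>] \<gamma>[OF \<nu>]] mult_kron[OF L L \<gamma>[OF \<nu>] \<gamma>[OF \<mu>]]
        lattice_derivative_commute[of Gs \<nu> \<mu>]
      by (rule kron_add_right[symmetric])
         (rule mult_carrier_mat[OF L L] mult_carrier_mat[OF \<gamma>[OF \<mu>] \<gamma>[OF \<nu>]] mult_carrier_mat[OF \<gamma>[OF \<nu>] \<gamma>[OF \<mu>]])+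
    also have "\<dots> = 0\<^sub>m ?n ?n"
      unfolding anti[OF \<mu> \<nu> neq] by (rule kron_zero_right) (rule mult_carrier_mat[OF L L])
    finally show "kron (?L \<mu>) (\<gamma> \<mu>) * kron (?L \<nu>) (\<gamma> \<nu>) + kron (?L \<nu>) (\<gamma> \<nu>) * kron (?L \<mu>) (\<gamma> \<mu>) = 0\<^sub>m ?n ?n" .
  qed (rule distinct_upt)
  then show ?thesis unfolding dirac_def lattice_derivative_def[symmetric]
    by (simp only: set_upt atLeast0LessThan lessThan_iff Ball_def)
qed

section \<open>Subspaces given by free coordinates\<close>

text \<open>
  Such a subspace has an explicit basis indexed by \<open>F\<close>, and subspaces of this form are stable under
  tensor products. A vanishing kernel is covered by \<open>w = 0\<close> and \<open>F = {}\<close>.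
\<close>
definition coord_determined :: "'a::field vec set \<Rightarrow> nat \<Rightarrow> nat set \<Rightarrow> bool" where
  "coord_determined V n F \<longleftrightarrow> F \<subseteq> {..<n} \<and>
     (\<exists>\<rho> w. (\<forall>j<n. \<rho> j < n \<and> (w j = 0 \<or> \<rho> j \<in> F)) \<and> (\<forall>j\<in>F. \<rho> j = j \<and> w j = 1) \<and>
        V = {v \<in> carrier_vec n. \<forall>j<n. v $ j = w j * v $ \<rho> j})"

text \<open>Restriction to the coordinates in \<open>F\<close> is an isomorphism: these entries are
  free and all others are multiples of them. The basis consists of the preimages of the unit
  vectors.\<close>

lemma kernel_dim_coord_determined:
  fixes A :: "'a::field mat"
  assumes A: "A \<in> carrier_mat m n" and F: "coord_determined (mat_kernel A) n F"
  shows "kernel_dim A = card F"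
proof -
  obtain \<rho> w where Fn: "F \<subseteq> {..<n}" and \<rho>: "\<And>j. j < n \<Longrightarrow> \<rho> j < n \<and> (w j = 0 \<or> \<rho> j \<in> F)"
    and \<rho>F: "\<And>j. j \<in> F \<Longrightarrow> \<rho> j = j \<and> w j = 1"
    and ker: "mat_kernel A = {v \<in> carrier_vec n. \<forall>j<n. v $ j = w j * v $ \<rho> j}"
    using F unfolding coord_determined_def by blast
  interpret kernel m n A by unfold_locales (rule A)
  have fin: "finite F" using Fn finite_subset by auto
  \<comment> \<open>The entry at \<open>f\<close> is 1, the other free entries are 0, and the
    relations fill in the rest along the fibre of \<open>\<rho>\<close> over
    \<open>f\<close>.\<close>
  define e where "e f = vec n (\<lambda>j. if \<rho> j = f then w j else 0)" for f
  have e_in: "e f \<in> mat_kernel A" for f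
    unfolding ker e_def using \<rho> \<rho>F by fastforce
  have eF: "e f $ g = (if f = g then 1 else 0)" if "f \<in> F" "g \<in> F" for f g
    using that Fn \<rho>F[of g] by (auto simp: e_def)
  have inj: "inj_on e F"
    by (rule inj_onI) (metis eF zero_neq_one)
  let ?B = "e ` F"
  have B: "?B \<subseteq> mat_kernel A" using e_in by auto
  have "Ker.lin_indpt ?B"
  proof (rule Ker.finite_lin_indpt2)
    show "finite ?B" using fin by simp
    show "?B \<subseteq> mat_kernel A" by (rule B)
    fix a :: "'a vec \<Rightarrow> 'a" assume "a \<in> ?B \<rightarrow> UNIV" and 0: "lincomb a ?B = 0\<^sub>v n"
    show "\<forall>v\<in>?B. a v = 0"
    proof
      fix v assume "v \<in> ?B"
      then obtain g where g: "g \<in> F" "v = e g" by auto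
      then have gn: "g < n" using Fn by auto
      have "0 = lincomb a ?B $ g" using 0 gn by simp
      also have "\<dots> = (\<Sum>f\<in>F. a (e f) * e f $ g)"
        by (simp add: lincomb_index[OF gn B] sum.reindex[OF inj])
      also have "\<dots> = (\<Sum>f\<in>F. if f = g then a (e f) else 0)"
        by (rule sum.cong) (auto simp: eF g)
      also have "\<dots> = a (e g)" using g fin by simp
      finally show "a v = 0" using g by simp
    qed
  qed
  moreover have "Ker.span ?B = mat_kernel A"
  proof
    show "Ker.span ?B \<subseteq> mat_kernel A" using B by (rule Ker.span_is_subset2)
    show "mat_kernel A \<subseteq> Ker.span ?B"
    proof
      fix v assume "v \<in> mat_kernel A"
      then have v: "v \<in> carrier_vec n" and vw: "\<And>j. j < n \<Longrightarrow> v $ j = w j * v $ \<rho> j" by (auto simp: ker)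
      \<comment> \<open>The coefficient of \<open>e f\<close> is the free entry
        \<open>v $ f\<close>; coefficients are indexed by basis vectors, hence the inverse of
        \<open>e\<close>.\<close>
      define a where "a b = v $ (inv_into F e b)" for b
      have "lincomb a ?B \<in> mat_kernel A" using B by (intro Ker.lincomb_closed) auto
      then have dim: "dim_vec (lincomb a ?B) = n" by (auto simp: ker)
      have "v = lincomb a ?B"
      proof (rule eq_vecI)
        fix j assume "j < dim_vec (lincomb a ?B)"
        then have j: "j < n" by (simp add: dim)
        have "lincomb a ?B $ j = (\<Sum>f\<in>F. v $ f * e f $ j)"
          by (simp add: lincomb_index[OF j B] sum.reindex[OF inj] a_def inv_into_f_f[OF inj])
        also have "\<dots> = (\<Sum>f\<in>F. if f = \<rho> j then w j * v $ \<rho> j else 0)"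
          using j by (intro sum.cong) (auto simp: e_def)
        also have "\<dots> = w j * v $ \<rho> j" using \<rho>[OF j] fin by auto
        finally show "v $ j = lincomb a ?B $ j" using vw[OF j] by simp
      qed (use v dim in auto)
      then show "v \<in> Ker.span ?B"
        unfolding Ker.span_def using fin by blast
    qed
  qed
  ultimately have "Ker.basis ?B" using B unfolding Ker.basis_def by auto
  then have "Ker.dim = card ?B" using fin by (intro Ker.dim_basis) auto
  then show ?thesis using A by (simp add: card_image[OF inj])
qed

text \<open>The tensor product of \<open>V1\<close> and \<open>V2\<close>, written as the arrays
  with \<open>n\<close> rows and \<open>m\<close> columns whose rows lie in \<open>V2\<close> and
  whose columns lie in \<open>V1\<close>. Its free entries form the grid
  \<open>F1 \<times> F2\<close>, and the weights multiply.\<close>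

lemma coord_determined_product:
  assumes V1: "coord_determined V1 n F1" and V2: "coord_determined V2 m F2"
  shows "\<exists>F. coord_determined {v \<in> carrier_vec (n * m).
            (\<forall>i<n. vec m (\<lambda>j. v $ (i * m + j)) \<in> V2) \<and> (\<forall>j<m. vec n (\<lambda>i. v $ (i * m + j)) \<in> V1)} (n * m) F
          \<and> card F = card F1 * card F2"
proof -
  obtain \<rho> w where F1: "F1 \<subseteq> {..<n}" and \<rho>: "\<And>j. j < n \<Longrightarrow> \<rho> j < n \<and> (w j = 0 \<or> \<rho> j \<in> F1)"
    and \<rho>F: "\<And>j. j \<in> F1 \<Longrightarrow> \<rho> j = j \<and> w j = 1"
    and V1: "V1 = {v \<in> carrier_vec n. \<forall>j<n. v $ j = w j * v $ \<rho> j}"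
    using V1 unfolding coord_determined_def by blast
  obtain \<sigma> u where F2: "F2 \<subseteq> {..<m}" and \<sigma>: "\<And>j. j < m \<Longrightarrow> \<sigma> j < m \<and> (u j = 0 \<or> \<sigma> j \<in> F2)"
    and \<sigma>F: "\<And>j. j \<in> F2 \<Longrightarrow> \<sigma> j = j \<and> u j = 1"
    and V2: "V2 = {v \<in> carrier_vec m. \<forall>j<m. v $ j = u j * v $ \<sigma> j}"
    using V2 unfolding coord_determined_def by blast
  let ?F = "(\<lambda>(i, j). i * m + j) ` (F1 \<times> F2)"
  define \<tau> where "\<tau> k = \<rho> (k div m) * m + \<sigma> (k mod m)" for k
  define z where "z k = w (k div m) * u (k mod m)" for k
  have "inj_on (\<lambda>(i, j). i * m + j) (F1 \<times> F2)"
  proof (rule inj_on_inverseI[where g = "\<lambda>k. (k div m, k mod m)"])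
    fix x assume "x \<in> F1 \<times> F2"
    with F2 show "((case x of (i, j) \<Rightarrow> i * m + j) div m, (case x of (i, j) \<Rightarrow> i * m + j) mod m) = x"
      by fastforce
  qed
  then have card: "card ?F = card F1 * card F2" by (simp add: card_image card_cartesian_product)
  have eq: "(\<forall>i<n. \<forall>j<m. v $ (i * m + j) = u j * v $ (i * m + \<sigma> j)) \<and>
            (\<forall>j<m. \<forall>i<n. v $ (i * m + j) = w i * v $ (\<rho> i * m + j)) \<longleftrightarrow>
            (\<forall>k<n * m. v $ k = z k * v $ \<tau> k)" (is "?L \<longleftrightarrow> ?R") for v :: "'a vec"
  proof
    assume L: ?L
    show ?R
    proof (intro allI impI)
      fix k assume k: "k < n * m"
      note d = div_mod_less[OF k]
      have "v $ k = v $ (k div m * m + k mod m)" by simp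
      also have "\<dots> = u (k mod m) * v $ (k div m * m + \<sigma> (k mod m))" using L d by blast
      also have "v $ (k div m * m + \<sigma> (k mod m)) = w (k div m) * v $ \<tau> k"
        unfolding \<tau>_def using L d \<sigma> by blast
      finally show "v $ k = z k * v $ \<tau> k" by (simp add: z_def)
    qed
  next
    assume R: ?R
    have v: "v $ (i * m + j) = w i * u j * v $ (\<rho> i * m + \<sigma> j)" if "i < n" "j < m" for i j
      using R mult_add_less[OF that] that by (simp add: z_def \<tau>_def)
    \<comment> \<open>Both sides reduce to the entry in row \<open>\<rho> i\<close> and column
      \<open>\<sigma> j\<close>: unless \<open>u j = 0\<close>, the index \<open>\<sigma> j\<close>
      lies in \<open>F2\<close>, where \<open>\<sigma>\<close> is the identity and the weight is
      1.\<close>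
    have "v $ (i * m + j) = u j * v $ (i * m + \<sigma> j)" if "i < n" "j < m" for i j
      using v[OF that] v[of i "\<sigma> j"] \<sigma>[OF that(2)] \<sigma>F[of "\<sigma> j"] that by auto
    moreover have "v $ (i * m + j) = w i * v $ (\<rho> i * m + j)" if "i < n" "j < m" for i j
      using v[OF that] v[of "\<rho> i" j] \<rho>[OF that(1)] \<rho>F[of "\<rho> i"] that by auto
    ultimately show ?L by blast
  qed
  have "coord_determined {v \<in> carrier_vec (n * m).
      (\<forall>i<n. vec m (\<lambda>j. v $ (i * m + j)) \<in> V2) \<and> (\<forall>j<m. vec n (\<lambda>i. v $ (i * m + j)) \<in> V1)} (n * m) ?F"
    unfolding coord_determined_def
  proof (intro conjI exI)
    show "?F \<subseteq> {..<n * m}"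
    proof safe
      fix i j assume "i \<in> F1" "j \<in> F2"
      with F1 F2 show "i * m + j < n * m" by (intro mult_add_less) auto
    qed
    show "\<forall>k<n * m. \<tau> k < n * m \<and> (z k = 0 \<or> \<tau> k \<in> ?F)"
    proof (intro allI impI)
      fix k assume "k < n * m"
      then have k: "k div m < n" "k mod m < m" by (rule div_mod_less)+
      have "\<tau> k < n * m"
        unfolding \<tau>_def using \<rho>[OF k(1)] \<sigma>[OF k(2)] by (intro mult_add_less) auto
      moreover have "z k = 0 \<or> \<tau> k \<in> ?F"
        unfolding \<tau>_def z_def using \<rho>[OF k(1)] \<sigma>[OF k(2)] by auto
      ultimately show "\<tau> k < n * m \<and> (z k = 0 \<or> \<tau> k \<in> ?F)" ..
    qed
    show "\<forall>k\<in>?F. \<tau> k = k \<and> z k = 1"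
    proof safe
      fix i j assume "i \<in> F1" "j \<in> F2"
      moreover then have "j < m" using F2 by auto
      ultimately show "\<tau> (i * m + j) = i * m + j" "z (i * m + j) = 1"
        using \<rho>F[of i] \<sigma>F[of j] by (auto simp: \<tau>_def z_def)
    qed
    show "{v \<in> carrier_vec (n * m).
      (\<forall>i<n. vec m (\<lambda>j. v $ (i * m + j)) \<in> V2) \<and> (\<forall>j<m. vec n (\<lambda>i. v $ (i * m + j)) \<in> V1)}
      = {v \<in> carrier_vec (n * m). \<forall>k<n * m. v $ k = z k * v $ \<tau> k}"
      unfolding eq[symmetric] V1 V2 using \<rho> \<sigma> by auto
  qed
  with card show ?thesis by blast
qed

text \<open>With \<open>v\<close> read row by row as an array of \<open>n\<close> rows and
  \<open>m\<close> columns, the right Kronecker factor acts inside each row.\<close>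

lemma kron_one_left_mult_vec_eq_0:
  fixes Q :: "'a::comm_ring_1 mat"
  assumes Q: "Q \<in> carrier_mat m m" and v: "v \<in> carrier_vec (n * m)"
  shows "kron (1\<^sub>m n) Q *\<^sub>v v = 0\<^sub>v (n * m) \<longleftrightarrow> (\<forall>i<n. Q *\<^sub>v vec m (\<lambda>j. v $ (i * m + j)) = 0\<^sub>v m)"
proof -
  have K: "kron (1\<^sub>m n) Q \<in> carrier_mat (n * m) (n * m)" using Q by auto
  have "(kron (1\<^sub>m n) Q *\<^sub>v v) $ (i * m + j) = (Q *\<^sub>v vec m (\<lambda>j. v $ (i * m + j))) $ j"
    if ij: "i < n" "j < m" for i j
  proof -
    note l = mult_add_less[OF ij]
    have "(kron (1\<^sub>m n) Q *\<^sub>v v) $ (i * m + j) = (\<Sum>k<n * m. kron (1\<^sub>m n) Q $$ (i * m + j, k) * v $ k)"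
      using K v l by (simp add: scalar_prod_def lessThan_atLeast0)
    also have "\<dots> = (\<Sum>k<n * m. (if i = k div m then 1 else 0) * Q $$ (j, k mod m) * v $ (k div m * m + k mod m))"
      using Q l ij div_mod_less[of _ n m] by (intro sum.cong) (auto simp: index_kron[OF one_carrier_mat Q])
    also have "\<dots> = (\<Sum>p<n. \<Sum>q<m. (if i = p then 1 else 0) * Q $$ (j, q) * v $ (p * m + q))"
      by (rule sum_div_mod[of "\<lambda>p q. (if i = p then 1 else 0) * Q $$ (j, q) * v $ (p * m + q)"])
    also have "\<dots> = (\<Sum>p<n. if i = p then \<Sum>q<m. Q $$ (j, q) * v $ (p * m + q) else 0)"
      by (intro sum.cong) auto
    also have "\<dots> = (\<Sum>q<m. Q $$ (j, q) * v $ (i * m + q))" using ij by simp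
    also have "\<dots> = (Q *\<^sub>v vec m (\<lambda>j. v $ (i * m + j))) $ j"
      using Q ij by (simp add: scalar_prod_def lessThan_atLeast0)
    finally show ?thesis .
  qed
  moreover have "kron (1\<^sub>m n) Q *\<^sub>v v = 0\<^sub>v (n * m) \<longleftrightarrow> (\<forall>k<n * m. (kron (1\<^sub>m n) Q *\<^sub>v v) $ k = 0)"
    using K by (auto simp: vec_eq_iff)
  moreover have "(\<forall>k<n * m. P k) \<longleftrightarrow> (\<forall>i<n. \<forall>j<m. P (i * m + j))" for P
    using mult_add_less[of _ n _ m] div_mod_less[of _ n m] by (metis div_mult_mod_eq)
  ultimately show ?thesis using Q by (auto simp: vec_eq_iff)
qed

text \<open>Dually, the left Kronecker factor acts inside each column.\<close>

lemma kron_one_right_mult_vec_eq_0: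
  fixes P :: "'a::comm_ring_1 mat"
  assumes P: "P \<in> carrier_mat n n" and v: "v \<in> carrier_vec (n * m)"
  shows "kron P (1\<^sub>m m) *\<^sub>v v = 0\<^sub>v (n * m) \<longleftrightarrow> (\<forall>j<m. P *\<^sub>v vec n (\<lambda>i. v $ (i * m + j)) = 0\<^sub>v n)"
proof -
  have K: "kron P (1\<^sub>m m) \<in> carrier_mat (n * m) (n * m)" using P by auto
  have "(kron P (1\<^sub>m m) *\<^sub>v v) $ (i * m + j) = (P *\<^sub>v vec n (\<lambda>i. v $ (i * m + j))) $ i"
    if ij: "i < n" "j < m" for i j
  proof -
    note l = mult_add_less[OF ij]
    have "(kron P (1\<^sub>m m) *\<^sub>v v) $ (i * m + j) = (\<Sum>k<n * m. kron P (1\<^sub>m m) $$ (i * m + j, k) * v $ k)"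
      using K v l by (simp add: scalar_prod_def lessThan_atLeast0)
    also have "\<dots> = (\<Sum>k<n * m. P $$ (i, k div m) * (if j = k mod m then 1 else 0) * v $ (k div m * m + k mod m))"
      using P l ij div_mod_less[of _ n m] by (intro sum.cong) (auto simp: index_kron[OF P one_carrier_mat])
    also have "\<dots> = (\<Sum>p<n. \<Sum>q<m. P $$ (i, p) * (if j = q then 1 else 0) * v $ (p * m + q))"
      by (rule sum_div_mod[of "\<lambda>p q. P $$ (i, p) * (if j = q then 1 else 0) * v $ (p * m + q)"])
    also have "\<dots> = (\<Sum>p<n. \<Sum>q<m. if j = q then P $$ (i, p) * v $ (p * m + q) else 0)"
      by (intro sum.cong) auto
    also have "\<dots> = (\<Sum>p<n. P $$ (i, p) * v $ (p * m + j))" using ij by simp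
    also have "\<dots> = (P *\<^sub>v vec n (\<lambda>i. v $ (i * m + j))) $ i"
      using P ij by (simp add: scalar_prod_def lessThan_atLeast0)
    finally show ?thesis .
  qed
  moreover have "kron P (1\<^sub>m m) *\<^sub>v v = 0\<^sub>v (n * m) \<longleftrightarrow> (\<forall>k<n * m. (kron P (1\<^sub>m m) *\<^sub>v v) $ k = 0)"
    using K by (auto simp: vec_eq_iff)
  moreover have "(\<forall>k<n * m. Q k) \<longleftrightarrow> (\<forall>i<n. \<forall>j<m. Q (i * m + j))" for Q
    using mult_add_less[of _ n _ m] div_mod_less[of _ n m] by (metis div_mult_mod_eq)
  ultimately show ?thesis using P by (auto simp: vec_eq_iff)
qed

section \<open>Kernels of the one-dimensional difference operators\<close>

fun factor_kernel_dim :: "factor \<Rightarrow> nat" where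
  "factor_kernel_dim (Cycle n) = (if even n then 2 else 1)"
| "factor_kernel_dim (Path n) = (if even n then 0 else 1)"

text \<open>Here \<open>a i\<close> and \<open>b i\<close> are the successor and predecessor of
  \<open>i\<close>. An index outside the range stands for a missing neighbour and contributes zero,
  which covers the ends of a path.\<close>

lemma mat_kernel_differences:
  fixes M :: "complex mat"
  assumes M: "M \<in> carrier_mat n n"
    and entry: "\<And>i j. \<lbrakk>i < n; j < n\<rbrakk> \<Longrightarrow> M $$ (i, j) = (if j = a i then 1 else 0) - (if j = b i then 1 else 0)"
  shows "mat_kernel M = {v \<in> carrier_vec n. \<forall>i<n. (if a i < n then v $ a i else 0) = (if b i < n then v $ b i else 0)}"
proof -
  have "(M *\<^sub>v v) $ i = (if a i < n then v $ a i else 0) - (if b i < n then v $ b i else 0)"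
    if v: "v \<in> carrier_vec n" and i: "i < n" for v i
  proof -
    have "(M *\<^sub>v v) $ i = (\<Sum>j<n. M $$ (i, j) * v $ j)"
      using M v i by (simp add: scalar_prod_def lessThan_atLeast0)
    also have "\<dots> = (\<Sum>j<n. (if j = a i then v $ j else 0) - (if j = b i then v $ j else 0))"
      using i by (intro sum.cong) (auto simp: entry)
    also have "\<dots> = (if a i < n then v $ a i else 0) - (if b i < n then v $ b i else 0)"
      by (simp add: sum_subtractf)
    finally show ?thesis .
  qed
  then show ?thesis
    using M unfolding mat_kernel[OF M] by (auto simp: vec_eq_iff)
qed

lemma mat_kernel_path:
  assumes "n \<ge> 2"
  shows "mat_kernel (A_as (Path n)) = {v \<in> carrier_vec n.
     v $ 1 = 0 \<and> v $ (n - 2) = 0 \<and> (\<forall>i. i + 2 < n \<longrightarrow> v $ (i + 2) = v $ i)}"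
proof -
  \<comment> \<open>The missing predecessor of 0 is coded as \<open>n\<close>, since truncated
    subtraction would return 0 itself.\<close>
  have "mat_kernel (A_as (Path n)) = {v \<in> carrier_vec n.
     \<forall>i<n. (if i + 1 < n then v $ (i + 1) else 0) =
           (if (if i = 0 then n else i - 1) < n then v $ (if i = 0 then n else i - 1) else 0)}"
    by (rule mat_kernel_differences) (auto simp: A_as_def antisym_adj_def)
  also have "\<dots> = {v \<in> carrier_vec n.
     v $ 1 = 0 \<and> v $ (n - 2) = 0 \<and> (\<forall>i. i + 2 < n \<longrightarrow> v $ (i + 2) = v $ i)}"
  proof (intro Collect_cong conj_cong refl iffI conjI allI impI)
    fix v :: "complex vec"
    assume *: "\<forall>i<n. (if i + 1 < n then v $ (i + 1) else 0) =
           (if (if i = 0 then n else i - 1) < n then v $ (if i = 0 then n else i - 1) else 0)"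
    show "v $ 1 = 0" using *[rule_format, of 0] assms by auto
    show "v $ (n - 2) = 0" using *[rule_format, of "n - 1"] assms by (auto simp: numeral_2_eq_2)
    show "v $ (i + 2) = v $ i" if "i + 2 < n" for i
      using *[rule_format, of "i + 1"] that by auto
  next
    fix v :: "complex vec" and i
    assume *: "v $ 1 = 0 \<and> v $ (n - 2) = 0 \<and> (\<forall>i. i + 2 < n \<longrightarrow> v $ (i + 2) = v $ i)" and i: "i < n"
    consider "i = 0" | "i = n - 1" "i > 0" | k where "i = k + 1" "k + 2 < n"
      using i by (metis Suc_eq_plus1 Suc_lessI add_2_eq_Suc' diff_Suc_1 gr0_conv_Suc neq0_conv)
    then show "(if i + 1 < n then v $ (i + 1) else 0) =
           (if (if i = 0 then n else i - 1) < n then v $ (if i = 0 then n else i - 1) else 0)"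
      using * assms by cases (auto simp: numeral_2_eq_2)
  qed
  finally show ?thesis .
qed

lemma mat_kernel_cycle:
  assumes "n \<ge> 3"
  shows "mat_kernel (A_as (Cycle n)) = {v \<in> carrier_vec n.
     v $ (n - 1) = v $ 1 \<and> v $ (n - 2) = v $ 0 \<and> (\<forall>i. i + 2 < n \<longrightarrow> v $ (i + 2) = v $ i)}"
proof -
  let ?a = "\<lambda>i. if i + 1 < n then i + 1 else 0" and ?b = "\<lambda>i. if i = 0 then n - 1 else i - 1"
  have "mat_kernel (A_as (Cycle n)) = {v \<in> carrier_vec n.
     \<forall>i<n. (if ?a i < n then v $ ?a i else 0) = (if ?b i < n then v $ ?b i else 0)}"
  proof (rule mat_kernel_differences)
    fix i j assume ij: "i < n" "j < n"
    have "(i + 1, j + 1) \<in> edges (Cycle n) \<longleftrightarrow> j = ?a i" "(j + 1, i + 1) \<in> edges (Cycle n) \<longleftrightarrow> j = ?b i"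
      using ij by auto
    \<comment> \<open>Uses \<open>n \<ge> 3\<close>: on two vertices the successor and the
      predecessor coincide.\<close>
    moreover have "?a i \<noteq> ?b i" using ij assms by auto
    ultimately show "A_as (Cycle n) $$ (i, j) = (if j = ?a i then 1 else 0) - (if j = ?b i then 1 else 0)"
      using ij unfolding A_as_def antisym_adj_def nverts.simps by (simp del: edges.simps)
  qed (simp add: A_as_def antisym_adj_def)
  also have "\<dots> = {v \<in> carrier_vec n. \<forall>i<n. v $ ?a i = v $ ?b i}"
  proof -
    have "?a i < n" "?b i < n" if "i < n" for i using that by auto
    then show ?thesis by (intro Collect_cong conj_cong refl) (simp only: if_True cong: imp_cong)
  qed
  also have "\<dots> = {v \<in> carrier_vec n.
     v $ (n - 1) = v $ 1 \<and> v $ (n - 2) = v $ 0 \<and> (\<forall>i. i + 2 < n \<longrightarrow> v $ (i + 2) = v $ i)}"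
  proof (intro Collect_cong conj_cong refl iffI conjI allI impI)
    fix v :: "complex vec"
    assume *: "\<forall>i<n. v $ ?a i = v $ ?b i"
    show "v $ (n - 1) = v $ 1" using *[rule_format, of 0] assms by auto
    show "v $ (n - 2) = v $ 0" using *[rule_format, of "n - 1"] assms by (auto simp: numeral_2_eq_2)
    show "v $ (i + 2) = v $ i" if "i + 2 < n" for i
      using *[rule_format, of "i + 1"] that by auto
  next
    fix v :: "complex vec" and i
    assume *: "v $ (n - 1) = v $ 1 \<and> v $ (n - 2) = v $ 0 \<and> (\<forall>i. i + 2 < n \<longrightarrow> v $ (i + 2) = v $ i)" and i: "i < n"
    consider "i = 0" | "i = n - 1" "i > 0" | k where "i = k + 1" "k + 2 < n"
      using i by (metis Suc_eq_plus1 Suc_lessI add_2_eq_Suc' diff_Suc_1 gr0_conv_Suc neq0_conv)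
    then show "v $ ?a i = v $ ?b i"
      using * assms by cases (auto simp: numeral_2_eq_2)
  qed
  finally show ?thesis .
qed

lemma two_step_periodic:
  fixes n j :: nat
  assumes "\<forall>i. i + 2 < n \<longrightarrow> f (i + 2) = f i" "j < n"
  shows "f j = f (j mod 2)"
  using assms(2)
proof (induction j rule: less_induct)
  case (less j)
  show ?case
  proof (cases "j < 2")
    case False
    then obtain k where "j = k + 2" by (metis add.commute le_Suc_ex not_less)
    then have "f j = f k" using assms(1) less.prems by simp
    also have "\<dots> = f (k mod 2)" using \<open>j = k + 2\<close> less by (intro less.IH) auto
    finally show ?thesis using \<open>j = k + 2\<close> by simp
  qed simp
qed

lemma coord_determined_mat_kernel_A_as:
  assumes "wf_factor G"
  shows "\<exists>F. coord_determined (mat_kernel (A_as G)) (nverts G) F \<and> card F = factor_kernel_dim G"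
proof (cases G)
  case (Cycle n)
  with assms have n: "n \<ge> 3" by simp
  \<comment> \<open>Around an even cycle parity is preserved, leaving two classes of equal entries.
    On an odd cycle the wrap-around relation joins the odd class to the even one.\<close>
  let ?\<rho> = "if even n then (\<lambda>j. j mod 2) else (\<lambda>j. 0)"
  let ?F = "if even n then {0, 1} else {0::nat}"
  have "coord_determined (mat_kernel (A_as G)) (nverts G) ?F"
    unfolding coord_determined_def
  proof (intro conjI exI)
    show "?F \<subseteq> {..<nverts G}" using n Cycle by auto
    show "\<forall>j<nverts G. ?\<rho> j < nverts G \<and> ((1::complex) = 0 \<or> ?\<rho> j \<in> ?F)"
      using n Cycle by auto
    show "\<forall>j\<in>?F. ?\<rho> j = j \<and> (1::complex) = 1" by auto
    show "mat_kernel (A_as G) = {v \<in> carrier_vec (nverts G). \<forall>j<nverts G. v $ j = 1 * v $ ?\<rho> j}"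
      unfolding Cycle mat_kernel_cycle[OF n] nverts.simps mult_1
    proof (intro Collect_cong conj_cong refl iffI conjI allI impI)
      fix v :: "complex vec" and j
      assume *: "v $ (n - 1) = v $ 1 \<and> v $ (n - 2) = v $ 0 \<and> (\<forall>i. i + 2 < n \<longrightarrow> v $ (i + 2) = v $ i)"
        and j: "j < n"
      have p: "v $ k = v $ (k mod 2)" if "k < n" for k
        using two_step_periodic[of n "\<lambda>k. v $ k"] * that by blast
      have "v $ 1 = v $ 0" if "odd n"
      proof -
        have "(n - 2) mod 2 = 1" using that n by presburger
        then show ?thesis using p[of "n - 2"] * n by simp
      qed
      then show "v $ j = v $ ?\<rho> j"
        using p[OF j] by (cases "even j") (auto simp: odd_iff_mod_2_eq_one)
    next
      fix v :: "complex vec"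
      assume *: "\<forall>j<n. v $ j = v $ ?\<rho> j"
      have v: "v $ j = v $ ?\<rho> j" if "j < n" for j using * that by blast
      have "(n - 1) mod 2 = 1" "(n - 2) mod 2 = 0" if "even n" using that n by presburger+
      then have \<rho>: "?\<rho> (n - 1) = ?\<rho> 1" "?\<rho> (n - 2) = 0" by auto
      show "v $ (n - 1) = v $ 1"
      proof -
        have "n - 1 < n" "1 < n" using n by auto
        then show ?thesis using v[of "n - 1", unfolded \<rho>] v[of 1] by metis
      qed
      show "v $ (n - 2) = v $ 0"
        by (rule v[of "n - 2", unfolded \<rho>]) (use n in simp)
      show "v $ (i + 2) = v $ i" if "i + 2 < n" for i
      proof -
        have "?\<rho> (i + 2) = ?\<rho> i" by simp
        then show ?thesis using v[of "i + 2"] v[of i] that by (metis add_lessD1)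
      qed
    qed
  qed
  then show ?thesis using Cycle by (intro exI[of _ ?F]) auto
next
  case (Path n)
  with assms have n: "n \<ge> 2" by simp
  \<comment> \<open>The condition at index 1 kills the odd class. The one at \<open>n - 2\<close>
    repeats this for odd \<open>n\<close> and kills the even class for even
    \<open>n\<close>.\<close>
  let ?w = "\<lambda>j. if odd n \<and> even j then 1 else 0 :: complex"
  let ?F = "if even n then {} else {0::nat}"
  have "coord_determined (mat_kernel (A_as G)) (nverts G) ?F"
    unfolding coord_determined_def
  proof (intro conjI exI)
    show "?F \<subseteq> {..<nverts G}" using n Path by auto
    show "\<forall>j<nverts G. (\<lambda>j. 0) j < nverts G \<and> (?w j = 0 \<or> (\<lambda>j. 0) j \<in> ?F)"
      using n Path by auto
    show "\<forall>j\<in>?F. (\<lambda>j. 0) j = j \<and> ?w j = 1" by auto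
    show "mat_kernel (A_as G) = {v \<in> carrier_vec (nverts G). \<forall>j<nverts G. v $ j = ?w j * v $ (\<lambda>j. 0) j}"
      unfolding Path mat_kernel_path[OF n] nverts.simps
    proof (intro Collect_cong conj_cong refl iffI conjI allI impI)
      fix v :: "complex vec" and j
      assume *: "v $ 1 = 0 \<and> v $ (n - 2) = 0 \<and> (\<forall>i. i + 2 < n \<longrightarrow> v $ (i + 2) = v $ i)"
        and j: "j < n"
      have p: "v $ k = v $ (k mod 2)" if "k < n" for k
        using two_step_periodic[of n "\<lambda>k. v $ k"] * that by blast
      have "v $ 0 = 0" if "even n"
      proof -
        have "(n - 2) mod 2 = 0" using that n by presburger
        then show ?thesis using p[of "n - 2"] * n by simp
      qed
      then show "v $ j = ?w j * v $ 0"
        using p[OF j] * by (cases "even j") (auto simp: odd_iff_mod_2_eq_one)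
    next
      fix v :: "complex vec"
      assume *: "\<forall>j<n. v $ j = ?w j * v $ 0"
      have "odd (n - 2)" if "odd n" using that n by presburger
      then show "v $ 1 = 0" "v $ (n - 2) = 0"
        using *[rule_format, of "n - 2"] *[rule_format, of 1] n by auto
      show "v $ (i + 2) = v $ i" if "i + 2 < n" for i
        using *[rule_format, of "i + 2"] *[rule_format, of i] that by simp
    qed
  qed
  then show ?thesis using Path by (intro exI[of _ ?F]) auto
qed

text \<open>The empty list leaves the spinor space, with \<open>r\<close> free coordinates. An
  appended factor is a new leftmost slot: the old constraints act on rows and the new one on
  columns, as in the product lemma.\<close>

lemma coord_determined_joint_kernel:
  assumes "\<forall>G\<in>set Gs. wf_factor G"
  shows "\<exists>F. coord_determined {v \<in> carrier_vec (total_verts Gs * r). \<forall>\<mu><length Gs.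
             kron (lattice_derivative Gs \<mu>) (1\<^sub>m r) *\<^sub>v v = 0\<^sub>v (total_verts Gs * r)} (total_verts Gs * r) F
           \<and> card F = (\<Prod>G\<leftarrow>Gs. factor_kernel_dim G) * r"
  using assms
proof (induction Gs rule: rev_induct)
  case Nil
  have "coord_determined (carrier_vec r) r {..<r}"
    unfolding coord_determined_def by (intro conjI exI[of _ "\<lambda>j. j"] exI[of _ "\<lambda>j. 1"]) auto
  then show ?case by (intro exI[of _ "{..<r}"]) simp
next
  case (snoc G Gs)
  let ?n = "nverts G" and ?N = "total_verts Gs"
  let ?m = "?N * r"
  define K where "K = {v \<in> carrier_vec ?m. \<forall>\<mu><length Gs. kron (lattice_derivative Gs \<mu>) (1\<^sub>m r) *\<^sub>v v = 0\<^sub>v ?m}"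
  obtain F where F: "coord_determined K ?m F" "card F = (\<Prod>G\<leftarrow>Gs. factor_kernel_dim G) * r"
    using snoc unfolding K_def by auto
  obtain E where E: "coord_determined (mat_kernel (A_as G)) ?n E" "card E = factor_kernel_dim G"
    using coord_determined_mat_kernel_A_as[of G] snoc.prems by auto
  have dim: "total_verts (Gs @ [G]) * r = ?n * ?m" by (simp add: mult_ac)
  have L: "kron (lattice_derivative Gs \<mu>) (1\<^sub>m r) \<in> carrier_mat ?m ?m" for \<mu>
    by (intro kron_carrier lattice_derivative_carrier one_carrier_mat)
  have old: "kron (lattice_derivative (Gs @ [G]) \<mu>) (1\<^sub>m r) = kron (1\<^sub>m ?n) (kron (lattice_derivative Gs \<mu>) (1\<^sub>m r))"
    if "\<mu> < length Gs" for \<mu>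
    using that by (simp add: lattice_derivative_snoc kron_assoc)
  have new: "kron (lattice_derivative (Gs @ [G]) (length Gs)) (1\<^sub>m r) = kron (A_as G) (1\<^sub>m ?m)"
    by (simp add: lattice_derivative_snoc kron_assoc lattice_derivative_outside kron_one)
  have "(\<forall>\<mu><length (Gs @ [G]). kron (lattice_derivative (Gs @ [G]) \<mu>) (1\<^sub>m r) *\<^sub>v v = 0\<^sub>v (?n * ?m)) \<longleftrightarrow>
       (\<forall>i<?n. vec ?m (\<lambda>j. v $ (i * ?m + j)) \<in> K) \<and> (\<forall>j<?m. vec ?n (\<lambda>i. v $ (i * ?m + j)) \<in> mat_kernel (A_as G))"
    if v: "v \<in> carrier_vec (?n * ?m)" for v
  proof -
    have "(\<forall>\<mu><length (Gs @ [G]). kron (lattice_derivative (Gs @ [G]) \<mu>) (1\<^sub>m r) *\<^sub>v v = 0\<^sub>v (?n * ?m)) \<longleftrightarrow>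
       (\<forall>\<mu><length Gs. kron (1\<^sub>m ?n) (kron (lattice_derivative Gs \<mu>) (1\<^sub>m r)) *\<^sub>v v = 0\<^sub>v (?n * ?m)) \<and>
       kron (A_as G) (1\<^sub>m ?m) *\<^sub>v v = 0\<^sub>v (?n * ?m)"
      using old new by (auto simp: less_Suc_eq)
    then show ?thesis
      unfolding kron_one_left_mult_vec_eq_0[OF L v] kron_one_right_mult_vec_eq_0[OF A_as_carrier v]
      by (auto simp: K_def mat_kernel[OF A_as_carrier])
  qed
  then have "{v \<in> carrier_vec (?n * ?m). \<forall>\<mu><length (Gs @ [G]).
      kron (lattice_derivative (Gs @ [G]) \<mu>) (1\<^sub>m r) *\<^sub>v v = 0\<^sub>v (?n * ?m)} =
    {v \<in> carrier_vec (?n * ?m).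
       (\<forall>i<?n. vec ?m (\<lambda>j. v $ (i * ?m + j)) \<in> K) \<and> (\<forall>j<?m. vec ?n (\<lambda>i. v $ (i * ?m + j)) \<in> mat_kernel (A_as G))}"
    by (intro Collect_cong conj_cong refl) auto
  with coord_determined_product[OF E(1) F(1)] show ?case
    unfolding dim by (auto simp: E(2) F(2) mult_ac)
qed

lemma kernel_dim_dirac:
  assumes wf: "\<forall>G\<in>set Gs. wf_factor G" and cliff: "clifford (length Gs) r \<gamma>"
  shows "kernel_dim (dirac Gs r \<gamma>) = (\<Prod>G\<leftarrow>Gs. factor_kernel_dim G) * r"
proof -
  have "\<gamma> \<mu> \<in> carrier_mat r r" if "\<mu> < length Gs" for \<mu>
    using cliff that by (simp add: clifford_def)
  then have "dirac Gs r \<gamma> \<in> carrier_mat (total_verts Gs * r) (total_verts Gs * r)"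
    unfolding dirac_def lattice_derivative_def[symmetric]
    by (intro foldr_add_carrier kron_carrier lattice_derivative_carrier) auto
  moreover obtain F where "coord_determined (mat_kernel (dirac Gs r \<gamma>)) (total_verts Gs * r) F"
      "card F = (\<Prod>G\<leftarrow>Gs. factor_kernel_dim G) * r"
    using coord_determined_joint_kernel[OF wf, of r] unfolding mat_kernel_dirac[OF assms] by blast
  ultimately show ?thesis using kernel_dim_coord_determined by metis
qed

lemma prod_factor_kernel_dim_le:
  "(\<Prod>G\<leftarrow>Gs. factor_kernel_dim G) \<le> 2 ^ length (filter is_cycle Gs)"
proof (induction Gs)
  case (Cons G Gs)
  have "factor_kernel_dim G \<le> (if is_cycle G then 2 else 1)" by (cases G) auto
  from mult_le_mono[OF this Cons.IH] show ?case by (auto split: if_splits)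
qed simp

lemma prod_factor_kernel_dim_eq:
  assumes "\<forall>G\<in>set Gs. if is_cycle G then even (nverts G) else odd (nverts G)"
  shows "(\<Prod>G\<leftarrow>Gs. factor_kernel_dim G) = 2 ^ length (filter is_cycle Gs)"
  using assms
proof (induction Gs)
  case (Cons G Gs)
  then have "factor_kernel_dim G = (if is_cycle G then 2 else 1)" by (cases G) auto
  with Cons show ?case by auto
qed simp

section \<open>Ranks of finitely generated free abelian groups\<close>

text \<open>The free abelian group of rank \<open>m\<close>. Fixing the tail to zero gives each
  element a unique representative and keeps all ranks in one type.\<close>

definition int_vec :: "nat \<Rightarrow> (nat \<Rightarrow> int) monoid" where
  "int_vec m = \<lparr>carrier = {f. \<forall>i\<ge>m. f i = 0}, mult = (\<lambda>f g i. f i + g i), one = (\<lambda>_. 0)\<rparr>"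

lemma int_vec_DirProd: "int_vec m \<times>\<times> int_vec n \<cong> int_vec (m + n)"
proof (rule is_isoI)
  let ?h = "\<lambda>(f, g) i. if i < m then f i else g (i - m) :: int"
  have "bij_betw ?h (carrier (int_vec m \<times>\<times> int_vec n)) (carrier (int_vec (m + n)))"
    by (rule bij_betw_byWitness[where f' = "\<lambda>h. (\<lambda>i. if i < m then h i else 0, \<lambda>i. h (i + m))"])
       (auto simp: int_vec_def fun_eq_iff)
  then show "?h \<in> iso (int_vec m \<times>\<times> int_vec n) (int_vec (m + n))"
    by (auto simp: iso_def hom_def int_vec_def fun_eq_iff)
qed

lemma int_vec_1: "integer_group \<cong> int_vec 1"
proof (rule is_isoI)
  let ?h = "\<lambda>k i. if i = 0 then k else 0 :: int"
  have "bij_betw ?h (carrier integer_group) (carrier (int_vec 1))"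
    by (rule bij_betw_byWitness[where f' = "\<lambda>h. h 0"]) (auto simp: int_vec_def fun_eq_iff)
  then show "?h \<in> iso integer_group (int_vec 1)"
    by (auto simp: iso_def hom_def int_vec_def fun_eq_iff)
qed

lemma trivial_group_iso_int_vec_0: "trivial_group G \<Longrightarrow> G \<cong> int_vec 0"
proof -
  assume G: "trivial_group G"
  then interpret group G by (simp add: trivial_group_def)
  have c: "carrier G = {\<one>\<^bsub>G\<^esub>}" using G by (simp add: trivial_group_def)
  have "(\<lambda>x. (\<lambda>_. 0)) \<in> iso G (int_vec 0)"
    by (auto simp: iso_def hom_def int_vec_def c bij_betw_def)
  then show ?thesis by (rule is_isoI)
qed

text \<open>Fraction-free Gaussian elimination of the last coordinate.\<close>
lemma integer_linear_relation:
  fixes f :: "'a \<Rightarrow> nat \<Rightarrow> int"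
  assumes "finite T" "m < card T"
  shows "\<exists>c. (\<exists>t\<in>T. c t \<noteq> 0) \<and> (\<forall>i<m. (\<Sum>t\<in>T. c t * f t i) = 0)"
  using assms
proof (induction m arbitrary: T f)
  case 0
  then show ?case by (intro exI[of _ "\<lambda>_. 1"]) (auto simp: card_gt_0_iff)
next
  case (Suc m)
  show ?case
  proof (cases "\<forall>t\<in>T. f t m = 0")
    case True
    from Suc.IH[of T f] Suc.prems obtain c where c: "\<exists>t\<in>T. c t \<noteq> 0" "\<forall>i<m. (\<Sum>t\<in>T. c t * f t i) = 0"
      by auto
    with True show ?thesis by (intro exI[of _ c]) (auto simp: less_Suc_eq)
  next
    case False
    then obtain u where u: "u \<in> T" "f u m \<noteq> 0" by auto
    let ?T = "T - {u}" and ?g = "\<lambda>t i. f u m * f t i - f t m * f u i"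
    from Suc.IH[of ?T ?g] Suc.prems u obtain c where c: "\<exists>t\<in>?T. c t \<noteq> 0"
       and rel: "\<forall>i<m. (\<Sum>t\<in>?T. c t * ?g t i) = 0"
      by (auto simp: less_diff_conv)
    \<comment> \<open>Clearing the pivot multiplies each old coefficient by \<open>f u m\<close>;
      the coefficient of \<open>u\<close> is then forced by the last coordinate.\<close>
    define d where "d t = (if t = u then - (\<Sum>t\<in>?T. c t * f t m) else c t * f u m)" for t
    have sum_d: "(\<Sum>t\<in>T. d t * f t i) = (\<Sum>t\<in>?T. c t * ?g t i)" for i
    proof -
      have "(\<Sum>t\<in>T. d t * f t i) = d u * f u i + (\<Sum>t\<in>?T. d t * f t i)"
        using Suc.prems u by (simp add: sum.remove)
      also have "(\<Sum>t\<in>?T. d t * f t i) = (\<Sum>t\<in>?T. c t * f u m * f t i)"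
        by (rule sum.cong) (auto simp: d_def)
      finally show ?thesis
        by (simp add: d_def sum_distrib_left sum_distrib_right algebra_simps sum_subtractf)
    qed
    have "(\<Sum>t\<in>T. d t * f t i) = 0" if "i < Suc m" for i
      unfolding sum_d using that rel by (cases "i = m") (auto simp: algebra_simps)
    moreover have "\<exists>t\<in>T. d t \<noteq> 0"
      using c u by (auto simp: d_def)
    ultimately show ?thesis by blast
  qed
qed

text \<open>Preimages of the unit vectors form an independent set of size \<open>m\<close>, and any
  larger finite set has an integer relation among its images. The supremum is thus an attained
  maximum.\<close>

lemma group_rank_iso_int_vec:
  assumes G: "comm_group G" and iso: "G \<cong> int_vec m"
  shows "group_rank G = m"
proof -
  interpret comm_group G by (rule G)
  obtain h where h: "h \<in> iso G (int_vec m)" using iso by (auto simp: is_iso_def)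
  have bij: "bij_betw h (carrier G) {f. \<forall>i\<ge>m. f i = 0}"
    and mult: "\<And>x y. \<lbrakk>x \<in> carrier G; y \<in> carrier G\<rbrakk> \<Longrightarrow> h (x \<otimes>\<^bsub>G\<^esub> y) = (\<lambda>i. h x i + h y i)"
    using h by (auto simp: iso_def hom_def int_vec_def)
  \<comment> \<open>Each coordinate is a homomorphism to the integers, so products of powers in
    \<open>G\<close> become integer linear combinations.\<close>
  have ghi: "group_hom G integer_group (\<lambda>x. h x i)" for i
    using group_integer_group by (auto simp: group_hom_def group_hom_axioms_def hom_def mult)
  have h1: "h \<one>\<^bsub>G\<^esub> i = 0" for i
    using group_hom.hom_one[OF ghi] by simp
  have hpow: "h (x [^]\<^bsub>G\<^esub> (k::int)) i = k * h x i" if "x \<in> carrier G" for x k i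
    using group_hom.hom_int_pow[OF ghi that] by simp
  have hsum: "h (finprod G (\<lambda>s. s [^]\<^bsub>G\<^esub> c s) S) i = (\<Sum>s\<in>S. c s * h s i)"
    if "finite S" "S \<subseteq> carrier G" for S i and c :: "_ \<Rightarrow> int"
    using that
  proof (induction S)
    case (insert x S)
    then have "finprod G (\<lambda>s. s [^]\<^bsub>G\<^esub> c s) S \<in> carrier G"
      by (intro finprod_closed) auto
    with insert show ?case
      by (subst finprod_insert) (auto simp: mult hpow)
  qed (simp add: h1)
  have rel: "finprod G (\<lambda>s. s [^]\<^bsub>G\<^esub> c s) S = \<one>\<^bsub>G\<^esub> \<longleftrightarrow> (\<forall>i<m. (\<Sum>s\<in>S. c s * h s i) = 0)"
    if "finite S" "S \<subseteq> carrier G" for S and c :: "_ \<Rightarrow> int"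
  proof -
    have in_G: "finprod G (\<lambda>s. s [^]\<^bsub>G\<^esub> c s) S \<in> carrier G"
      using that by (auto intro!: finprod_closed)
    have "finprod G (\<lambda>s. s [^]\<^bsub>G\<^esub> c s) S = \<one>\<^bsub>G\<^esub> \<longleftrightarrow> h (finprod G (\<lambda>s. s [^]\<^bsub>G\<^esub> c s) S) = h \<one>\<^bsub>G\<^esub>"
      using bij in_G by (auto simp: bij_betw_def inj_on_def)
    also have "\<dots> \<longleftrightarrow> (\<forall>i<m. h (finprod G (\<lambda>s. s [^]\<^bsub>G\<^esub> c s) S) i = 0)"
      using bij_betwE[OF bij] in_G by (auto simp: fun_eq_iff h1) (meson not_le)
    finally show ?thesis by (simp add: hsum[OF that])
  qed
  define e where "e j = (\<lambda>i. if i = j then 1 else 0 :: int)" for j :: nat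
  define g where "g j = inv_into (carrier G) h (e j)" for j
  have g: "g j \<in> carrier G" "h (g j) = e j" if "j < m" for j
  proof -
    have "e j \<in> h ` carrier G" using bij that by (auto simp: bij_betw_def e_def)
    then show "g j \<in> carrier G" "h (g j) = e j"
      unfolding g_def by (auto intro: inv_into_into f_inv_into_f)
  qed
  have inj: "inj_on g {..<m}"
  proof (rule inj_onI)
    fix i j assume "i \<in> {..<m}" "j \<in> {..<m}" "g i = g j"
    then have "e i i = e j i" using g by (metis lessThan_iff)
    then show "i = j" by (auto simp: e_def split: if_splits)
  qed
  show ?thesis unfolding group_rank_def
  proof (rule cSup_eq_maximum)
    let ?S = "g ` {..<m}"
    have "\<forall>s\<in>?S. c s = 0" if "finprod G (\<lambda>s. s [^]\<^bsub>G\<^esub> c s) ?S = \<one>\<^bsub>G\<^esub>" for c :: "_ \<Rightarrow> int"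
    proof -
      have "\<forall>i<m. (\<Sum>s\<in>?S. c s * h s i) = 0"
        using rel[of ?S c] that g by auto
      moreover have "(\<Sum>s\<in>?S. c s * h s i) = c (g i)" if "i < m" for i
        using that by (simp add: sum.reindex[OF inj] g e_def if_distrib[of "\<lambda>x. _ * x"] cong: if_cong)
      ultimately show ?thesis by auto
    qed
    then show "m \<in> {card S | S. S \<subseteq> carrier G \<and> finite S \<and>
      (\<forall>c. finprod G (\<lambda>s. s [^]\<^bsub>G\<^esub> (c s::int)) S = \<one>\<^bsub>G\<^esub> \<longrightarrow> (\<forall>s\<in>S. c s = 0))}"
      using g card_image[OF inj] by (intro CollectI exI[of _ ?S]) auto
  next
    fix x assume "x \<in> {card S | S. S \<subseteq> carrier G \<and> finite S \<and>
      (\<forall>c. finprod G (\<lambda>s. s [^]\<^bsub>G\<^esub> (c s::int)) S = \<one>\<^bsub>G\<^esub> \<longrightarrow> (\<forall>s\<in>S. c s = 0))}"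
    then obtain S where S: "x = card S" "S \<subseteq> carrier G" "finite S"
      "\<And>c. finprod G (\<lambda>s. s [^]\<^bsub>G\<^esub> (c s::int)) S = \<one>\<^bsub>G\<^esub> \<Longrightarrow> (\<forall>s\<in>S. c s = 0)"
      by auto
    show "x \<le> m"
    proof (rule ccontr)
      assume "\<not> x \<le> m"
      with S integer_linear_relation[of S m h] obtain c
        where "\<exists>t\<in>S. c t \<noteq> 0" "\<forall>i<m. (\<Sum>t\<in>S. c t * h t i) = 0" by auto
      with S rel[of S c] show False by auto
    qed
  qed
qed

section \<open>Homology of products with a circle\<close>

lemma homotopic_project_contractible:
  assumes J: "contractible_space J" and a: "a \<in> topspace J"
  shows "homotopic_with (\<lambda>h. True) (prod_topology X J) (prod_topology X J) (\<lambda>z. (fst z, a)) id"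
proof -
  have 1: "homotopic_with (\<lambda>h. True) J J id (\<lambda>x. a)"
    using J a homotopic_into_contractible_space[of J J id "\<lambda>x. a"] by simp
  have "homotopic_with (\<lambda>h. True) (prod_topology X J) (prod_topology X J)
          (\<lambda>z. (id (fst z), (\<lambda>x. a) (snd z))) (\<lambda>z. (id (fst z), id (snd z)))"
    by (rule homotopic_with_prod_topology[where p="\<lambda>h. True" and q="\<lambda>h. True"])
       (use 1 in \<open>auto simp: homotopic_with_sym[of _ J] simp flip: id_def\<close>)
  then show ?thesis by (simp add: id_def)
qed

lemma homology_group_prod_contractible:
  assumes J: "contractible_space J" and a: "a \<in> topspace J"
  shows "homology_group p (prod_topology X J) \<cong> homology_group p X"
proof (rule homotopy_equivalent_space_imp_isomorphic_homology_groups)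
  show "prod_topology X J homotopy_equivalent_space X"
    unfolding homotopy_equivalent_space_def
  proof (intro exI conjI)
    show "continuous_map (prod_topology X J) X fst" by (rule continuous_map_fst)
    show "continuous_map X (prod_topology X J) (\<lambda>x. (x, a))"
      using a by (simp add: continuous_map_pairedI)
    show "homotopic_with (\<lambda>x. True) (prod_topology X J) (prod_topology X J) ((\<lambda>x. (x, a)) \<circ> fst) id"
      using homotopic_project_contractible[OF J a] by (simp add: o_def)
    show "homotopic_with (\<lambda>x. True) X X (fst \<circ> (\<lambda>x. (x, a))) id"
      by (simp add: o_def flip: id_def)
  qed
qed

text \<open>Collapsing the second factor to \<open>a\<close> is homotopic to the identity both on
  the whole product and on the part over \<open>K\<close>, so the inclusion is a homotopy
  equivalence.\<close>

lemma trivial_relative_homology_group_prod_contractible: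
  assumes J: "contractible_space J" and K: "contractible_space (subtopology J K)"
    and a: "a \<in> K" and KJ: "K \<subseteq> topspace J"
  shows "trivial_group (relative_homology_group p (prod_topology X J) (topspace X \<times> K))"
proof -
  have sub: "subtopology (prod_topology X J) (topspace X \<times> K) = prod_topology X (subtopology J K)"
    by (metis subtopology_Times subtopology_topspace)
  show ?thesis
  proof (rule trivial_relative_homology_group_gen)
    show "continuous_map (prod_topology X J) (subtopology (prod_topology X J) (topspace X \<times> K)) (\<lambda>z. (fst z, a))"
      unfolding sub using a KJ by (auto intro!: continuous_map_pairedI continuous_map_fst)
    show "homotopic_with (\<lambda>h. True) (subtopology (prod_topology X J) (topspace X \<times> K))
       (subtopology (prod_topology X J) (topspace X \<times> K)) (\<lambda>z. (fst z, a)) id"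
      unfolding sub by (rule homotopic_project_contractible[OF K]) (use a KJ in auto)
    show "homotopic_with (\<lambda>k. True) (prod_topology X J) (prod_topology X J) (\<lambda>z. (fst z, a)) id"
      by (rule homotopic_project_contractible[OF J]) (use a KJ in auto)
  qed
qed

text \<open>Radial projection retracts the cone onto its trace on the sphere, and retracts of
  contractible spaces are contractible. Arcs of the circle are thereby handled through convex or
  star-shaped regions of the plane.\<close>

lemma contractible_sphere_Int_cone:
  fixes K :: "'a::real_normed_vector set"
  assumes K: "contractible K" and 0: "0 \<notin> K"
    and scale: "\<And>c x. \<lbrakk>c > 0; x \<in> K\<rbrakk> \<Longrightarrow> c *\<^sub>R x \<in> K"
  shows "contractible (sphere 0 1 \<inter> K)"
proof -
  let ?r = "\<lambda>x. (1 / norm x) *\<^sub>R x"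
  have "continuous_on K ?r"
    using 0 by (intro continuous_intros) auto
  moreover have "?r ` K \<subseteq> sphere 0 1 \<inter> K"
  proof safe
    fix x assume "x \<in> K"
    with 0 have "norm x > 0" by auto
    with \<open>x \<in> K\<close> show "?r x \<in> sphere 0 1" "?r x \<in> K"
      by (auto intro!: scale)
  qed
  ultimately have "retraction_map (top_of_set K) (top_of_set (sphere 0 1 \<inter> K)) ?r"
    unfolding retraction_map_def retraction_maps_def
    by (intro exI[of _ id]) (auto simp: continuous_on_id)
  then show ?thesis
    using contractible_space_retraction_map_image K by fastforce
qed

text \<open>
  The slice over \<open>1\<close> is a retract, so only the homology relative to it is left. That slice may be
  enlarged to the part over \<open>U\<close>, the circle without \<open>-1\<close>; excising the right half of the circle
  leaves the arc \<open>L\<close> relative to \<open>L\<close> without \<open>-1\<close>, which is the union \<open>E\<close> of two arcs. As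
  \<open>L\<close> relative to the arc \<open>E1\<close> is acyclic, the triple shifts the degree and identifies the
  result with the homology over the other arc \<open>E2\<close>.
\<close>
lemma homology_group_prod_circle:
  "homology_group p (prod_topology X circle_top) \<cong> homology_group p X \<times>\<times> homology_group (p - 1) X"
proof -
  let ?S = "sphere (0::complex) 1"
  define Y where "Y = prod_topology X circle_top"
  define on where "on T = topspace X \<times> (?S \<inter> T)" for T
  have sub: "subtopology Y (on T) = prod_topology X (subtopology euclidean (?S \<inter> T))" for T
    unfolding Y_def circle_top_def on_def
    by (metis subtopology_Times subtopology_subtopology subtopology_topspace inf.left_idem)
  have contr: "contractible_space (subtopology euclidean (?S \<inter> T))"
    if "contractible T" "0 \<notin> T" "\<And>c x. \<lbrakk>c > 0; x \<in> T\<rbrakk> \<Longrightarrow> c *\<^sub>R x \<in> T" for T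
    using contractible_sphere_Int_cone[OF that] by simp
  \<comment> \<open>\<open>L\<close> is an open half-plane, \<open>E1\<close> and \<open>E2\<close>
    are its upper and lower quadrants; the slit plane \<open>U\<close> is only star-shaped, not
    convex.\<close>
  define L E E1 E2 where "L = {z::complex. Re z < 0}" and "E = {z. Re z < 0 \<and> Im z \<noteq> 0}"
    and "E1 = {z. Re z < 0 \<and> Im z > 0}" and "E2 = {z. Re z < 0 \<and> Im z < 0}"
  define U :: "complex set" where "U = - (complex_of_real ` {..0})"
  have U_eq: "U = {z. Re z > 0 \<or> Im z \<noteq> 0}"
    by (auto simp: U_def image_iff complex_eq_iff not_le)
  have cL: "contractible_space (subtopology euclidean (?S \<inter> L))"
    by (rule contr) (auto simp: L_def mult_pos_neg intro!: convex_imp_contractible convex_halfspace_Re_lt)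
  have cv: "convex E1" "convex E2"
    unfolding E1_def E2_def Collect_conj_eq
    by (intro convex_Int convex_halfspace_Re_lt convex_halfspace_Im_lt convex_halfspace_Im_gt)+
  have cE1: "contractible_space (subtopology euclidean (?S \<inter> E1))"
    by (rule contr) (auto simp: E1_def mult_pos_neg intro!: convex_imp_contractible[OF cv(1)[unfolded E1_def]])
  have cE2: "contractible_space (subtopology euclidean (?S \<inter> E2))"
    by (rule contr) (auto simp: E2_def mult_pos_neg intro!: convex_imp_contractible[OF cv(2)[unfolded E2_def]])
  have cU: "contractible_space (subtopology euclidean (?S \<inter> U))"
  proof (rule contr)
    show "contractible U" unfolding U_def
      by (rule starlike_imp_contractible, rule starlike_slotted_complex_plane_left)
    show "c *\<^sub>R x \<in> U" if "c > 0" "x \<in> U" for c x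
      using that by (auto simp: U_eq mult_less_0_iff)
  qed (auto simp: U_def)
  have opn: "openin Y (on T)" if "open T" for T
    unfolding Y_def on_def circle_top_def openin_prod_Times_iff
    using that by (auto simp: openin_open)
  have top: "topspace Y = topspace X \<times> ?S" by (simp add: Y_def circle_top_def)
  have E12: "on E = on E1 \<union> on E2" "on E1 \<inter> on E2 = {}"
    by (auto simp: E_def E1_def E2_def on_def)
  define W where "W = {z::complex. Re z \<ge> 0}"
  have E1E: "on E1 \<subseteq> on E" and EL: "on E \<inter> on L = on E" "on L \<inter> on E = on E" and oneU: "on {1} \<subseteq> on U"
    and UW: "on U - on W = on E" and LY: "topspace Y - on W = on L" and UY: "on U \<subseteq> topspace Y"
    and E21: "on E - on E1 = on E2"
    by (auto simp: on_def U_eq E_def E1_def E2_def L_def W_def top)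
  have triv_U: "trivial_group (relative_homology_group q (subtopology Y (on U)) (on {1}))" for q
  proof -
    have "on {1} = topspace X \<times> {1}" by (auto simp: on_def)
    moreover have "1 \<in> topspace (top_of_set (?S \<inter> U))" by (auto simp: U_eq)
    ultimately show ?thesis unfolding sub
      using trivial_relative_homology_group_prod_contractible[OF cU, of "{1}" 1] by auto
  qed
  have triv_L: "trivial_group (relative_homology_group q (subtopology Y (on L)) (on E1))" for q
  proof -
    \<comment> \<open>The triple 3, 4, 5 supplies a rational point of the circle as base point; its
      conjugate serves for \<open>E2\<close>.\<close>
    have "?S \<inter> E1 \<subseteq> ?S \<inter> L" "Complex (-3/5) (4/5) \<in> ?S \<inter> E1"
      by (auto simp: E1_def L_def cmod_def power2_eq_square)
    then show ?thesis unfolding sub unfolding on_def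
      by (intro trivial_relative_homology_group_prod_contractible[OF cL])
         (use cE1 in \<open>auto simp: subtopology_subtopology Int_absorb1\<close>)
  qed
  \<comment> \<open>In the exact sequence of the triple, homology of \<open>on U\<close> relative to
    \<open>on {1}\<close> stands on both sides of this map and vanishes.\<close>
  have "relative_homology_group p Y (on {1}) \<cong> relative_homology_group p Y (on U)"
    using homology_exactness_triple_1[OF oneU, of p Y] homology_exactness_triple_3[OF oneU, of p Y]
    by (intro is_isoI[OF very_short_exact_sequence[OF _ triv_U triv_U]]) auto
  moreover have "relative_homology_group p (subtopology Y (on L)) (on E) \<cong> relative_homology_group p Y (on U)"
  proof -
    have "open L" unfolding L_def by (intro open_Collect_less continuous_intros)
    then have "closedin Y (on W)"
      unfolding closedin_def LY using opn[of L] by (auto simp: on_def top)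
    moreover have "open U"
      unfolding U_eq
      by (intro open_Collect_disj open_Collect_less open_Collect_neq continuous_intros)
    \<comment> \<open>A point of the circle with real part 0 has nonzero imaginary part, so the
      closed right half lies in the open set \<open>U\<close>.\<close>
    ultimately have "Y closure_of (on W) \<subseteq> Y interior_of (on U)"
      using opn by (auto simp: closure_of_closedin interior_of_openin on_def U_eq W_def cmod_def)
    from homology_excision_axiom[OF this UY] show ?thesis
      unfolding LY UW by (auto intro: is_isoI)
  qed
  \<comment> \<open>The boundary map of the triple stands between two groups that vanish by
    \<open>triv_L\<close>; this is where the degree drops by one.\<close>
  moreover have "relative_homology_group p (subtopology Y (on L)) (on E) \<cong>
                 relative_homology_group (p-1) (subtopology Y (on E)) (on E1)"
    using homology_exactness_triple_1[OF E1E, of p "subtopology Y (on L)"]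
      homology_exactness_triple_2[OF E1E, of p "subtopology Y (on L)"]
    unfolding subtopology_subtopology EL
    by (intro is_isoI[OF very_short_exact_sequence[OF _ triv_L triv_L]]) auto
  \<comment> \<open>\<open>on E1\<close> is open and closed in \<open>on E\<close>, so it can be
    excised as a whole, leaving \<open>on E2\<close> relative to the empty set.\<close>
  moreover have "homology_group (p-1) (subtopology Y (on E2)) \<cong>
                 relative_homology_group (p-1) (subtopology Y (on E)) (on E1)"
  proof -
    let ?Z = "subtopology Y (on E)"
    have "open E1" "open E2"
      unfolding E1_def E2_def
      by (intro open_Collect_conj open_Collect_less continuous_intros)+
    then have "openin Y (on E1)" "openin Y (on E2)" using opn by auto
    moreover have "topspace ?Z = on E" by (auto simp: top on_def)
    ultimately have "openin ?Z (on E1)" "closedin ?Z (on E1)"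
      using E1E E21 by (auto simp: openin_subtopology closedin_def)
    then have "?Z closure_of (on E1) \<subseteq> ?Z interior_of (on E1)"
      by (simp add: closure_of_closedin interior_of_openin)
    from homology_excision_axiom[OF this E1E] show ?thesis
      unfolding E21 subtopology_subtopology
      using E12 by (auto intro: is_isoI simp: Int_absorb1)
  qed
  moreover have "homology_group (p-1) (subtopology Y (on E2)) \<cong> homology_group (p-1) X"
    unfolding sub
    by (rule homology_group_prod_contractible[OF cE2, of "Complex (-3/5) (-4/5)"])
       (auto simp: E2_def cmod_def power2_eq_square)
  ultimately have rel: "relative_homology_group p Y (on {1}) \<cong> homology_group (p-1) X"
    by (meson group.iso_sym group_relative_homology_group iso_trans)
  \<comment> \<open>A retract makes the exact sequence of the pair split, which yields the direct
    product.\<close>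
  have "on {1} retract_of_space Y"
    unfolding retract_of_space_def
  proof (intro conjI exI ballI)
    show "continuous_map Y (subtopology Y (on {1})) (\<lambda>z. (fst z, 1))"
      unfolding sub unfolding Y_def by (auto intro!: continuous_map_pairedI continuous_map_fst)
  qed (auto simp: on_def top)
  then have "homology_group p Y \<cong>
      homology_group p (subtopology Y (on {1})) \<times>\<times> relative_homology_group p Y (on {1})"
    by (intro isomorphic_group_homology_group_prod_retract) auto
  moreover have "homology_group p (subtopology Y (on {1})) \<cong> homology_group p X"
    unfolding sub by (rule homology_group_prod_contractible[of _ 1]) auto
  ultimately show ?thesis unfolding Y_def[symmetric]
    using rel by (meson group.DirProd_iso_trans group_relative_homology_group iso_trans)
qed

section \<open>Betti numbers of the product space\<close>

lemma product_topology_cong: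
  assumes "\<And>i. i \<in> I \<Longrightarrow> T i = S i"
  shows "product_topology T I = product_topology S I"
proof -
  have "{PiE I X | X. (\<forall>i. openin (T i) (X i)) \<and> finite {i. X i \<noteq> topspace (T i)}}
      \<subseteq> {PiE I X | X. (\<forall>i. openin (S i) (X i)) \<and> finite {i. X i \<noteq> topspace (S i)}}"
    if TS: "\<And>i. i \<in> I \<Longrightarrow> T i = S i" for T S :: "'a \<Rightarrow> 'b topology"
  proof safe
    fix X assume X: "\<forall>i. openin (T i) (X i)" "finite {i. X i \<noteq> topspace (T i)}"
    \<comment> \<open>The generating boxes constrain a side for every index, even outside
      \<open>I\<close>. Those sides do not affect the box and are reset to the whole space.\<close>
    let ?X = "\<lambda>i. if i \<in> I then X i else topspace (S i)"
    have "PiE I X = PiE I ?X" by (rule PiE_cong) simp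
    moreover have "\<forall>i. openin (S i) (?X i)" using X(1) TS by (metis openin_topspace)
    moreover have "finite {i. ?X i \<noteq> topspace (S i)}"
      by (rule finite_subset[OF _ X(2)]) (use TS in auto)
    ultimately show "\<exists>Y. PiE I X = PiE I Y \<and> (\<forall>i. openin (S i) (Y i)) \<and> finite {i. Y i \<noteq> topspace (S i)}"
      by blast
  qed
  from this[of T S] this[of S T] assms show ?thesis
    unfolding product_topology_def by (intro arg_cong[of _ _ topology_generated_by] equalityI) auto
qed

lemma homeomorphic_product_space_snoc:
  "product_space (Gs @ [G]) homeomorphic_space
     prod_topology (product_space Gs) (if is_cycle G then circle_top else interval_top)"
proof -
  define n where "n = length Gs"
  define T where "T i = (if is_cycle ((Gs @ [G]) ! i) then circle_top else interval_top)" for i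
  have 1: "product_space (Gs @ [G]) = product_topology T {..<Suc n}"
    by (simp add: product_space_def T_def[abs_def] n_def)
  \<comment> \<open>The families read from \<open>Gs\<close> and from \<open>Gs @ [G]\<close> may
    disagree from index \<open>n\<close> on, hence the congruence.\<close>
  have 2: "product_space Gs = product_topology T {..<n}"
    unfolding product_space_def n_def
    by (rule product_topology_cong) (auto simp: T_def nth_append)
  have 3: "(if is_cycle G then circle_top else interval_top) = T n" by (simp add: T_def n_def)
  show ?thesis unfolding 1 2 3 homeomorphic_space_def homeomorphic_maps_def
  proof (intro exI conjI ballI)
    show "continuous_map (product_topology T {..<Suc n}) (prod_topology (product_topology T {..<n}) (T n))
            (\<lambda>f. (restrict f {..<n}, f n))"
      by (intro continuous_map_pairedI)
         (auto simp: continuous_map_componentwise intro!: continuous_map_product_projection)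
    show "continuous_map (prod_topology (product_topology T {..<n}) (T n)) (product_topology T {..<Suc n})
            (\<lambda>z. (fst z)(n := snd z))"
      unfolding continuous_map_componentwise
    proof (intro conjI ballI)
      show "(\<lambda>z. (fst z)(n := snd z)) ` topspace (prod_topology (product_topology T {..<n}) (T n))
              \<subseteq> extensional {..<Suc n}"
        by (auto simp: PiE_def extensional_def)
      fix k assume "k \<in> {..<Suc n}"
      then show "continuous_map (prod_topology (product_topology T {..<n}) (T n)) (T k)
              (\<lambda>z. ((fst z)(n := snd z)) k)"
        using continuous_map_compose[OF continuous_map_fst continuous_map_product_projection[of k "{..<n}" T], of "T n"]
        by (cases "k = n") (auto simp: o_def continuous_map_snd)
    qed
  qed (auto simp: fun_eq_iff PiE_def extensional_def restrict_def)
qed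

lemma contractible_interval_top: "contractible_space interval_top"
  unfolding interval_top_def contractible_space_top_of_set
  by (intro convex_imp_contractible convex_linear_image)
     (auto intro!: bounded_linear.linear bounded_linear_of_real)

text \<open>A circle factor brings in degree \<open>p - 1\<close>, so the claim ranges over all
  integers \<open>p\<close>. Negative degrees need their own case: \<open>nat p\<close> is 0 there
  and would give the binomial coefficient 1.\<close>

lemma homology_group_product_space:
  "homology_group p (product_space Gs) \<cong>
     int_vec (if p < 0 then 0 else length (filter is_cycle Gs) choose nat p)"
proof (induction Gs arbitrary: p rule: rev_induct)
  case Nil
  \<comment> \<open>The empty product is a single point, the function undefined everywhere.\<close>
  have top: "topspace (product_space []) = {\<lambda>x. undefined}"
    by (simp add: product_space_def)
  show ?case
  proof (cases "p = 0")
    case True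
    have "path_connected_space (product_space [])"
      using contractible_imp_path_connected_space[of "product_space []"]
        contractible_space_subset_singleton[of "product_space []"] top by auto
    then have "homology_group 0 (product_space []) \<cong> integer_group"
      by (rule isomorphic_integer_zeroth_homology_group) (simp add: top)
    with True show ?thesis using int_vec_1 iso_trans by auto
  next
    case False
    then have "trivial_group (homology_group p (product_space []))"
      using homology_dimension_axiom[OF top] by blast
    with False show ?thesis using trivial_group_iso_int_vec_0 by (auto simp: binomial_eq_0)
  qed
next
  case (snoc G Gs)
  define b where "b p n = (if p < 0 then 0 else n choose nat p)" for p :: int and n :: nat
  let ?d = "length (filter is_cycle Gs)"
  note homeo = homeomorphic_space_imp_isomorphic_homology_groups[OF homeomorphic_product_space_snoc[of Gs G], of p]
  show ?case
  proof (cases "is_cycle G")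
    case True
    have "homology_group p (product_space (Gs @ [G])) \<cong>
       homology_group p (product_space Gs) \<times>\<times> homology_group (p - 1) (product_space Gs)"
      using homeo homology_group_prod_circle[of p "product_space Gs"] True iso_trans by auto
    moreover have "\<dots> \<cong> int_vec (b p ?d) \<times>\<times> int_vec (b (p - 1) ?d)"
      using snoc[of p] snoc[of "p - 1"] unfolding b_def
      by (intro group.DirProd_iso_trans) auto
    moreover have "\<dots> \<cong> int_vec (b p ?d + b (p - 1) ?d)"
      by (rule int_vec_DirProd)
    \<comment> \<open>Pascal's rule, with the degrees up to 0 treated separately.\<close>
    moreover have "b p ?d + b (p - 1) ?d = b p (Suc ?d)"
    proof (cases "p \<le> 0")
      case False
      then obtain k where "p = int (Suc k)" by (metis linorder_not_le zero_less_imp_eq_int gr0_conv_Suc)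
      then show ?thesis by (simp add: b_def nat_add_distrib)
    qed (auto simp: b_def)
    ultimately show ?thesis
      using True by (auto simp: b_def intro: iso_trans)
  next
    case False
    have "homology_group p (product_space (Gs @ [G])) \<cong> homology_group p (product_space Gs)"
      using homeo homology_group_prod_contractible[OF contractible_interval_top, of 0 p "product_space Gs"]
        False iso_trans by (auto simp: interval_top_def image_iff)
    with snoc[of p] False show ?thesis by (auto intro: iso_trans)
  qed
qed

lemma betti_product_space:
  "betti (int k) (product_space Gs) = length (filter is_cycle Gs) choose k"
  unfolding betti_def
  using group_rank_iso_int_vec[OF abelian_homology_group homology_group_product_space[of "int k" Gs]]
  by simp

lemma sum_betti_product_space:
  "(\<Sum>k = 0..length Gs. betti (int k) (product_space Gs)) = 2 ^ length (filter is_cycle Gs)"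
proof -
  \<comment> \<open>Degrees above the number of cycles contribute nothing, and that number is at
    most \<open>length Gs\<close>.\<close>
  have "(\<Sum>k = 0..length Gs. betti (int k) (product_space Gs))
      = (\<Sum>k \<le> length (filter is_cycle Gs). length (filter is_cycle Gs) choose k)"
    unfolding betti_product_space
    by (rule sum.mono_neutral_right) (auto intro: order_trans[OF _ length_filter_le])
  then show ?thesis by (simp add: choose_row_sum)
qed

theorem mainTheorem8:
  fixes Gs :: "factor list" and r :: nat and \<gamma> :: "nat \<Rightarrow> complex mat"
  assumes wf: "\<forall>G \<in> set Gs. wf_factor G"
    and r_pos: "r > 0"
    and cliff: "clifford (length Gs) r \<gamma>"
  shows "((\<forall>G \<in> set Gs. if is_cycle G then even (nverts G) else odd (nverts G)) \<longrightarrow>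
           real (kernel_dim (dirac Gs r \<gamma>)) / real r
             = real (\<Sum>k = 0..length Gs. betti (int k) (product_space Gs)))
         \<and> real (kernel_dim (dirac Gs r \<gamma>)) / real r
             \<le> real (\<Sum>k = 0..length Gs. betti (int k) (product_space Gs))"
proof -
  let ?k = "\<Prod>G\<leftarrow>Gs. factor_kernel_dim G" and ?d = "length (filter is_cycle Gs)"
  have "real (kernel_dim (dirac Gs r \<gamma>)) / real r = real ?k"
    using r_pos by (simp add: kernel_dim_dirac[OF wf cliff])
  moreover have "real ?k \<le> real (2 ^ ?d)"
    by (rule of_nat_mono) (rule prod_factor_kernel_dim_le)
  ultimately show ?thesis
    unfolding sum_betti_product_space using prod_factor_kernel_dim_eq[of Gs] by metis
qed

end
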